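(* Assume $d=2$. There exist universal constants $c$ and $C$ such that for all $r\ge 0$ and all $y\in\mathbb R^2$ with $|y|>1+r+c(1+\sqrt r)$, $$C_P(1,y,r)\le C\,(1+r^2).$$
   Context: For $y\in\mathbb R^2$, $r\ge0$, $C_P(1,y,r)$ is the Poincaré constant of the probability measure $\mu_{1,r}(dx)=Z^{-1}\mathbf 1_{|x-y|>r}\,e^{-|x|^2}\,dx$ on $\mathbb R^2$ (Euclidean norm, $Z$ normalizing): the smallest $C$ such that $\mathrm{Var}_{\mu_{1,r}}(f)\le C\int|\nabla f|^2\,d\mu_{1,r}$ for all smooth $f:\mathbb R^2\to\mathbb R$ (with $f,|\nabla f|\in L^2(\mu_{1,r})$). *)

theory Defs
  imports "HOL-Probability.Probability"
begin

text \<open>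
  \<open>C_k k f\<close> says that \<open>f\<close> is of class \<open>C\<^sup>k\<close> on the whole space. For \<open>Suc k\<close>: \<open>f\<close> is Frechet
  differentiable everywhere and all its directional derivatives are of class \<open>C\<^sup>k\<close>.
\<close>

primrec C_k :: "nat \<Rightarrow> ('a::euclidean_space \<Rightarrow> real) \<Rightarrow> bool" where
  "C_k 0 f \<longleftrightarrow> continuous_on UNIV f"
| "C_k (Suc k) f \<longleftrightarrow>
     (\<forall>x. f differentiable (at x)) \<and> (\<forall>v. C_k k (\<lambda>x. frechet_derivative f (at x) v))"

definition smooth :: "('a::euclidean_space \<Rightarrow> real) \<Rightarrow> bool" where
  "smooth f \<longleftrightarrow> (\<forall>k. C_k k f)"

definition gradient :: "('a::euclidean_space \<Rightarrow> real) \<Rightarrow> 'a \<Rightarrow> 'a" where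
  "gradient f x = (THE D. GDERIV f x :> D)"

definition poincare_inequality :: "('a::euclidean_space) measure \<Rightarrow> real \<Rightarrow> bool" where
  "poincare_inequality M C \<longleftrightarrow>
     (\<forall>f. smooth f \<longrightarrow> integrable M (\<lambda>x. (f x)\<^sup>2) \<longrightarrow> integrable M (\<lambda>x. (norm (gradient f x))\<^sup>2) \<longrightarrow>
        prob_space.variance M f \<le> C * (LINT x|M. (norm (gradient f x))\<^sup>2))"

text \<open>
  The value is \<open>\<infinity>\<close> if no real constant is admissible. Otherwise the infimum is attained, since
  the inequality is closed in \<open>C\<close>.
\<close>

definition poincare_constant :: "('a::euclidean_space) measure \<Rightarrow> ereal" where
  "poincare_constant M = Inf {ereal C |C. poincare_inequality M C}"

definition obstacle_weight :: "real^2 \<Rightarrow> real \<Rightarrow> real^2 \<Rightarrow> real" where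
  "obstacle_weight y r x = indicator {x. norm (x - y) > r} x * exp (- (norm x)\<^sup>2)"

definition obstacle_measure :: "real^2 \<Rightarrow> real \<Rightarrow> (real^2) measure" where
  "obstacle_measure y r =
     density lborel (\<lambda>x. ennreal (obstacle_weight y r x / (LINT z|lborel. obstacle_weight y r z)))"

end

theory Submission
  imports Defs
begin

text \<open>
  Take \<open>c = 0\<close> and use coordinates \<open>(s, t)\<close> in which \<open>y = (Y, 0)\<close>, so that the strip \<open>V = {\<bar>s\<bar> \<le> 1}\<close>
  avoids the obstacle. It suffices to bound \<open>\<integral> (f - a)\<^sup>2 exp (-\<bar>x\<bar>\<^sup>2)\<close> by the Dirichlet energy for a single
  constant \<open>a\<close>. On the unit square this is an elementary Poincare inequality. A one-dimensional Gaussian Hardy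
  inequality, in which the mass on a half-line is controlled by the mass on its first unit interval and
  the energy, carries the bound from the square to \<open>V\<close> (in the direction \<open>t\<close>), and from \<open>V\<close> to all
  points that see \<open>V\<close> along the direction \<open>s\<close>.

  What remains is the shadow of the disc. Hardy's inequality reduces it to its part within distance
  \<open>1\<close> of the disc, which a rotation by the angle \<open>\<plusminus>\<pi>\<close> about \<open>y\<close> moves to the front of the disc. The
  direction of the rotation can be chosen such that the Gaussian weight is nowhere below its initial
  value on the path. The path has length at most \<open>\<pi> (r + 1)\<close>, which is the source of the factor \<open>1 + r\<^sup>2\<close>.
\<close>

section \<open>A one-dimensional Gaussian Hardy inequality\<close>

lemma nn_integral_Icc_continuous:
  fixes f :: "real \<Rightarrow> real"
  assumes "continuous_on {a..b} f" "\<And>x. x \<in> {a..b} \<Longrightarrow> 0 \<le> f x"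
  shows "(\<integral>\<^sup>+x\<in>{a..b}. ennreal (f x) \<partial>lborel) = ennreal (integral {a..b} f)"
proof -
  have i: "set_integrable lborel {a..b} f"
    by (rule borel_integrable_atLeastAtMost'[OF assms(1)])
  have "(\<integral>\<^sup>+x\<in>{a..b}. ennreal (f x) \<partial>lborel) = (\<integral>\<^sup>+x. ennreal (indicator {a..b} x *\<^sub>R f x) \<partial>lborel)"
    by (intro nn_integral_cong) (auto simp: indicator_def)
  also have "\<dots> = ennreal (LINT x:{a..b}|lborel. f x)"
    using i assms(2) unfolding set_integrable_def set_lebesgue_integral_def
    by (intro nn_integral_eq_integral) (auto simp: indicator_def)
  finally show ?thesis
    using set_borel_integral_eq_integral(2)[OF i] by simp
qed

text \<open>Cauchy-Schwarz for the integral of \<open>g'\<close>, obtained by integrating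
  \<open>(g' t - k)\<^sup>2 \<ge> 0\<close> with \<open>k\<close> the mean slope of
  \<open>g\<close>.\<close>

lemma diff_square_le_nn_integral:
  fixes g g' :: "real \<Rightarrow> real"
  assumes der: "\<And>t. (g has_real_derivative g' t) (at t)" and cont: "continuous_on UNIV g'"
    and "a \<le> b"
  shows "ennreal ((g b - g a)\<^sup>2) \<le> ennreal (b - a) * (\<integral>\<^sup>+t\<in>{a..b}. ennreal ((g' t)\<^sup>2) \<partial>lborel)"
proof (cases "a = b")
  case False
  then have ab: "a < b" using assms by simp
  define k where "k = (g b - g a) / (b - a)"
  have c: "continuous_on {a..b} g'" using cont continuous_on_subset by blast
  have i1: "(g' has_integral (g b - g a)) {a..b}"
    by (rule fundamental_theorem_of_calculus[OF \<open>a \<le> b\<close>])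
      (use der has_real_derivative_iff_has_vector_derivative has_vector_derivative_at_within in blast)
  have i2: "((\<lambda>t. (g' t)\<^sup>2) has_integral integral {a..b} (\<lambda>t. (g' t)\<^sup>2)) {a..b}"
    by (intro integrable_integral integrable_continuous_interval continuous_intros c)
  have "((\<lambda>t. (g' t)\<^sup>2 - 2 * k * g' t + k\<^sup>2) has_integral
      integral {a..b} (\<lambda>t. (g' t)\<^sup>2) - 2 * k * (g b - g a) + (b - a) * k\<^sup>2) {a..b}"
    using has_integral_const_real[of "k\<^sup>2" a b] ab
    by (intro has_integral_add has_integral_diff i2 has_integral_mult_right i1) auto
  then have "0 \<le> integral {a..b} (\<lambda>t. (g' t)\<^sup>2) - 2 * k * (g b - g a) + (b - a) * k\<^sup>2" (is "0 \<le> ?R")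
  proof (rule has_integral_nonneg)
    fix t show "0 \<le> (g' t)\<^sup>2 - 2 * k * g' t + k\<^sup>2"
      using zero_le_power2[of "g' t - k"] by (simp add: power2_diff algebra_simps)
  qed
  moreover have "g b - g a = k * (b - a)"
    using ab by (simp add: k_def)
  ultimately have "k\<^sup>2 * (b - a) \<le> integral {a..b} (\<lambda>t. (g' t)\<^sup>2)"
    by (simp add: power2_eq_square algebra_simps)
  from mult_left_mono[OF this, of "b - a"] have "(g b - g a)\<^sup>2 \<le> (b - a) * integral {a..b} (\<lambda>t. (g' t)\<^sup>2)"
    using ab \<open>g b - g a = k * (b - a)\<close> by (simp add: power2_eq_square mult_ac)
  then show ?thesis
    using ab c by (subst nn_integral_Icc_continuous)
      (auto intro!: continuous_intros simp flip: ennreal_mult' intro: ennreal_leI)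
qed simp

text \<open>The decay of the Gaussian weight makes the derivative of
  \<open>(g t)\<^sup>2 * exp (-t\<^sup>2)\<close> contain the mass itself with a negative sign. No
  boundary condition on \<open>g\<close> is imposed, so the mass on a unit window stands in for the
  value at \<open>m\<close>. The constants are uniform in \<open>m\<close> and \<open>N\<close>,
  since the end points will vary from slice to slice.\<close>

lemma gaussian_hardy_Icc:
  fixes g g' :: "real \<Rightarrow> real"
  assumes der: "\<And>t. (g has_real_derivative g' t) (at t)" and cont: "continuous_on UNIV g'"
    and "0 \<le> m"
  shows "(\<integral>\<^sup>+t\<in>{m..N}. ennreal ((g t)\<^sup>2 * exp (-t\<^sup>2)) \<partial>lborel)
    \<le> 5 * (\<integral>\<^sup>+t\<in>{m..m+1}. ennreal ((g t)\<^sup>2 * exp (-t\<^sup>2)) \<partial>lborel)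
      + 4 * (\<integral>\<^sup>+t\<in>{m..N}. ennreal ((g' t)\<^sup>2 * exp (-t\<^sup>2)) \<partial>lborel)"
proof (cases "m + 1 \<le> N")
  case False
  have "(\<integral>\<^sup>+t\<in>{m..N}. ennreal ((g t)\<^sup>2 * exp (-t\<^sup>2)) \<partial>lborel)
      \<le> 1 * (\<integral>\<^sup>+t\<in>{m..m+1}. ennreal ((g t)\<^sup>2 * exp (-t\<^sup>2)) \<partial>lborel)"
    unfolding mult_1 using False by (intro nn_integral_mono) (auto simp: indicator_def)
  also have "\<dots> \<le> 5 * (\<integral>\<^sup>+t\<in>{m..m+1}. ennreal ((g t)\<^sup>2 * exp (-t\<^sup>2)) \<partial>lborel)"
    by (rule mult_right_mono) auto
  finally show ?thesis by (rule order_trans) simp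
next
  case True
  define p where "p t = (g t)\<^sup>2 * exp (-t\<^sup>2)" for t
  define q where "q t = (g' t)\<^sup>2 * exp (-t\<^sup>2)" for t
  have cg: "continuous_on UNIV g" using der DERIV_continuous_on by blast
  have cp: "continuous_on A p" for A
    unfolding p_def by (intro continuous_intros continuous_on_subset[OF cg]) auto
  have cq: "continuous_on A q" for A
    unfolding q_def by (intro continuous_intros continuous_on_subset[OF cont]) auto
  have p0: "0 \<le> p t" and q0: "0 \<le> q t" for t by (auto simp: p_def q_def)
  have ip: "p integrable_on {u..v}" and iq: "q integrable_on {u..v}" for u v
    by (intro integrable_continuous_interval cp cq)+
  \<comment> \<open>Integrate \<open>(- p)' = 2 t p - 2 g g' exp (-t\<^sup>2)\<close> from a point \<open>s\<close> where the boundary term \<open>p s\<close> is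
    bounded by the mass on \<open>{m..m+1}\<close>; \<open>s \<ge> 1/2\<close> ensures \<open>2 t \<ge> 1\<close>.\<close>
  obtain s where s: "s \<in> {m+1/2..m+1}" and smin: "\<And>t. t \<in> {m+1/2..m+1} \<Longrightarrow> p s \<le> p t"
    using continuous_attains_inf[OF _ _ cp, of "{m+1/2..m+1}"] by auto
  have "p s / 2 \<le> integral {m+1/2..m+1} p"
    using integral_le[of "\<lambda>_. p s" "{m+1/2..m+1}" p] smin ip
      integrable_const_ivl[of "p s" "m+1/2" "m+1"] by simp
  also have "\<dots> \<le> integral {m..m+1} p"
    by (rule integral_subset_le) (auto intro: ip p0)
  finally have ps: "p s \<le> 2 * integral {m..m+1} p" by simp
  have "((\<lambda>t. 2 * t * p t - 2 * g t * g' t * exp (-t\<^sup>2)) has_integral (- p N - - p s)) {s..N}"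
    using s True unfolding p_def
    by (intro fundamental_theorem_of_calculus)
       (auto intro!: derivative_eq_intros DERIV_subset[OF der]
          simp: algebra_simps power2_eq_square simp flip: has_real_derivative_iff_has_vector_derivative)
  then have "integral {s..N} (\<lambda>t. p t / 2 - 2 * q t) \<le> - p N - - p s"
  proof (rule has_integral_le[OF integrable_integral, rotated])
    show "(\<lambda>t. p t / 2 - 2 * q t) integrable_on {s..N}"
      using cp[of "{s..N}"] cq[of "{s..N}"] by (intro integrable_continuous_interval continuous_intros) auto
  next
    fix t assume "t \<in> {s..N}"
    then have t: "1 \<le> 2 * t" using s \<open>0 \<le> m\<close> by auto
    \<comment> \<open>Young's inequality, weighted so that the cross term costs only half of
      \<open>p t\<close>; the term \<open>2 * t * p t \<ge> p t\<close> absorbs it and leaves the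
      other half.\<close>
    have "2 * g t * g' t \<le> (g t)\<^sup>2 / 2 + 2 * (g' t)\<^sup>2"
      using zero_le_power2[of "g t - 2 * g' t"] by (simp add: power2_diff power_mult_distrib)
    then have "2 * g t * g' t * exp (-t\<^sup>2) \<le> ((g t)\<^sup>2 / 2 + 2 * (g' t)\<^sup>2) * exp (-t\<^sup>2)"
      by (rule mult_right_mono) simp
    moreover have "p t \<le> 2 * t * p t" using mult_right_mono[OF t p0] by simp
    ultimately show "p t / 2 - 2 * q t \<le> 2 * t * p t - 2 * g t * g' t * exp (-t\<^sup>2)"
      by (simp add: p_def q_def algebra_simps)
  qed
  moreover have "integral {s..N} (\<lambda>t. p t / 2 - 2 * q t) = integral {s..N} p / 2 - 2 * integral {s..N} q"
    using ip iq by (subst integral_diff) (auto intro!: integrable_on_mult_right integrable_on_divide)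
  ultimately have "integral {s..N} p \<le> 2 * p s + 4 * integral {s..N} q"
    using p0[of N] by simp
  moreover have "integral {s..N} q \<le> integral {m..N} q"
    using s \<open>0 \<le> m\<close> by (intro integral_subset_le) (auto intro: iq q0)
  moreover have "integral {m..s} p \<le> integral {m..m+1} p"
    using s \<open>0 \<le> m\<close> by (intro integral_subset_le) (auto intro: ip p0)
  moreover have "integral {m..N} p = integral {m..s} p + integral {s..N} p"
    using s True ip[of m N] by (intro Henstock_Kurzweil_Integration.integral_combine[symmetric]) auto
  \<comment> \<open>The factor \<open>5\<close> is \<open>1\<close> for the piece before
    \<open>s\<close> plus \<open>2 * 2\<close> for the boundary term \<open>2 * p s\<close>.\<close>
  ultimately have fin: "integral {m..N} p \<le> 5 * integral {m..m+1} p + 4 * integral {m..N} q"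
    using ps by simp
  have nn: "0 \<le> integral {u..v} p" "0 \<le> integral {u..v} q" for u v
    by (auto intro!: integral_nonneg ip iq p0 q0)
  have e: "(\<integral>\<^sup>+t\<in>{u..v}. ennreal (p t) \<partial>lborel) = ennreal (integral {u..v} p)"
    "(\<integral>\<^sup>+t\<in>{u..v}. ennreal (q t) \<partial>lborel) = ennreal (integral {u..v} q)" for u v
    by (auto intro!: nn_integral_Icc_continuous cp cq p0 q0)
  show ?thesis
    unfolding p_def[symmetric] q_def[symmetric] e
    using ennreal_leI[OF fin] nn by (simp add: ennreal_plus ennreal_mult)
qed

lemma nn_integral_atLeast_SUP:
  assumes [measurable]: "h \<in> borel_measurable borel"
  shows "(\<integral>\<^sup>+t\<in>{m..}. h t \<partial>lborel) = (SUP n. \<integral>\<^sup>+t\<in>{m..real n}. h t \<partial>lborel)"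
proof -
  have "(\<integral>\<^sup>+t\<in>{m..}. h t \<partial>lborel) = (\<integral>\<^sup>+t. (SUP n. h t * indicator {m..real n} t) \<partial>lborel)"
  proof (rule nn_integral_cong)
    fix t :: real
    obtain n0 where "t \<le> real n0" using real_arch_simple by blast
    then have "h t * indicator {m..} t \<le> h t * indicator {m..real n0} t"
      by (auto simp: indicator_def)
    then have "h t * indicator {m..} t \<le> (SUP n. h t * indicator {m..real n} t)"
      by (rule order_trans) (rule SUP_upper, simp)
    moreover have "(SUP n. h t * indicator {m..real n} t) \<le> h t * indicator {m..} t"
      by (rule SUP_least) (auto simp: indicator_def)
    ultimately show "h t * indicator {m..} t = (SUP n. h t * indicator {m..real n} t)" by simp
  qed
  also have "\<dots> = (SUP n. \<integral>\<^sup>+t\<in>{m..real n}. h t \<partial>lborel)"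
    by (rule nn_integral_monotone_convergence_SUP)
      (auto simp: incseq_def le_fun_def indicator_def)
  finally show ?thesis .
qed

lemma gaussian_hardy_atLeast:
  fixes g g' :: "real \<Rightarrow> real"
  assumes der: "\<And>t. (g has_real_derivative g' t) (at t)" and cont: "continuous_on UNIV g'"
    and "0 \<le> m"
  shows "(\<integral>\<^sup>+t\<in>{m..}. ennreal ((g t)\<^sup>2 * exp (-t\<^sup>2)) \<partial>lborel)
    \<le> 5 * (\<integral>\<^sup>+t\<in>{m..m+1}. ennreal ((g t)\<^sup>2 * exp (-t\<^sup>2)) \<partial>lborel)
      + 4 * (\<integral>\<^sup>+t\<in>{m..}. ennreal ((g' t)\<^sup>2 * exp (-t\<^sup>2)) \<partial>lborel)"
proof -
  have "continuous_on UNIV g" using der DERIV_continuous_on by blast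
  then have [measurable]: "g \<in> borel_measurable borel" by (rule borel_measurable_continuous_onI)
  show ?thesis
  proof (subst nn_integral_atLeast_SUP)
    show "(SUP n. \<integral>\<^sup>+t\<in>{m..real n}. ennreal ((g t)\<^sup>2 * exp (-t\<^sup>2)) \<partial>lborel)
      \<le> 5 * (\<integral>\<^sup>+t\<in>{m..m+1}. ennreal ((g t)\<^sup>2 * exp (-t\<^sup>2)) \<partial>lborel)
      + 4 * (\<integral>\<^sup>+t\<in>{m..}. ennreal ((g' t)\<^sup>2 * exp (-t\<^sup>2)) \<partial>lborel)"
      by (intro SUP_least order_trans[OF gaussian_hardy_Icc[OF assms]] add_left_mono mult_left_mono nn_integral_mono)
        (auto simp: indicator_def)
  qed measurable
qed

lemma nn_integral_reflect:
  assumes [measurable]: "h \<in> borel_measurable borel"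
  shows "(\<integral>\<^sup>+t. h (- t) \<partial>lborel) = (\<integral>\<^sup>+t. h (t::real) \<partial>lborel)"
  using nn_integral_real_affine[of h "-1" 0] by simp

text \<open>Reflection at the origin of the half-line case with \<open>m = 0\<close>.\<close>

lemma gaussian_hardy_atMost:
  fixes g g' :: "real \<Rightarrow> real"
  assumes der: "\<And>t. (g has_real_derivative g' t) (at t)" and cont: "continuous_on UNIV g'"
  shows "(\<integral>\<^sup>+t\<in>{..0}. ennreal ((g t)\<^sup>2 * exp (-t\<^sup>2)) \<partial>lborel)
    \<le> 5 * (\<integral>\<^sup>+t\<in>{-1..0}. ennreal ((g t)\<^sup>2 * exp (-t\<^sup>2)) \<partial>lborel)
      + 4 * (\<integral>\<^sup>+t\<in>{..0}. ennreal ((g' t)\<^sup>2 * exp (-t\<^sup>2)) \<partial>lborel)"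
proof -
  have "continuous_on UNIV g" using der DERIV_continuous_on by blast
  then have [measurable]: "g \<in> borel_measurable borel" "g' \<in> borel_measurable borel"
    using cont by (auto intro: borel_measurable_continuous_onI)
  have r: "(\<integral>\<^sup>+t\<in>A. ennreal ((h (- t))\<^sup>2 * exp (-t\<^sup>2)) \<partial>lborel) = (\<integral>\<^sup>+t\<in>B. ennreal ((h t)\<^sup>2 * exp (-t\<^sup>2)) \<partial>lborel)"
    if [measurable]: "h \<in> borel_measurable borel" "B \<in> sets borel" and "\<And>t. t \<in> A \<longleftrightarrow> - t \<in> B"
    for h :: "real \<Rightarrow> real" and A B
    using nn_integral_reflect[of "\<lambda>t. ennreal ((h t)\<^sup>2 * exp (-t\<^sup>2)) * indicator B t"] that(3)
    by (simp add: indicator_def)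
  have d: "((\<lambda>x. g (- x)) has_real_derivative - g' (- t)) (at t)" for t
    using DERIV_chain2[OF der DERIV_minus[OF DERIV_ident], of t] by simp
  have "(\<integral>\<^sup>+t\<in>{0..}. ennreal ((g (-t))\<^sup>2 * exp (-t\<^sup>2)) \<partial>lborel)
    \<le> 5 * (\<integral>\<^sup>+t\<in>{0..0+1}. ennreal ((g (-t))\<^sup>2 * exp (-t\<^sup>2)) \<partial>lborel)
      + 4 * (\<integral>\<^sup>+t\<in>{0..}. ennreal ((- g' (-t))\<^sup>2 * exp (-t\<^sup>2)) \<partial>lborel)"
    by (rule gaussian_hardy_atLeast)
      (auto intro!: continuous_intros continuous_on_compose2[OF cont] simp: d)
  then show ?thesis
    by (simp add: r[of g "{..0}"] r[of g "{-1..0}" "{0..1}"] conj_commute r[of g' "{..0}"])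
qed

section \<open>Orthonormal frames in the plane\<close>

text \<open>\<open>lborel\<close> is determined by its values on boxes. The preimage of a box under
  \<open>f\<close> is its image under the orthogonal map \<open>inv f\<close>, which preserves
  Lebesgue measure.\<close>

lemma lborel_distr_orthogonal_transformation:
  fixes f :: "real^'n::{finite,wellorder} \<Rightarrow> real^'n::_"
  assumes f: "orthogonal_transformation f"
  shows "distr lborel borel f = lborel"
proof (rule sym, rule lborel_eqI)
  have cont: "continuous_on UNIV f"
    using f by (simp add: linear_continuous_on linear_linear orthogonal_transformation_linear)
  then have [measurable]: "f \<in> borel_measurable borel"
    by (rule borel_measurable_continuous_onI)
  fix l u :: "real^'n::_"
  assume le: "\<And>b. b \<in> Basis \<Longrightarrow> l \<bullet> b \<le> u \<bullet> b"
  have bij: "bij f" by (rule orthogonal_transformation_bij[OF f])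
  have vi: "f -` box l u = inv f ` box l u"
    using bij by (simp add: bij_vimage_eq_inv_image)
  have inv: "orthogonal_transformation (inv f)"
    using f by (rule orthogonal_transformation_inv)
  have lm: "inv f ` box l u \<in> lmeasurable"
    by (rule measurable_orthogonal_image[OF inv]) auto
  have borel: "inv f ` box l u \<in> sets borel"
    unfolding vi[symmetric] using cont by (intro borel_open open_vimage) auto
  have "emeasure (distr lborel borel f) (box l u) = emeasure lebesgue (inv f ` box l u)"
    using borel by (simp add: emeasure_distr vi)
  also have "\<dots> = ennreal (measure lebesgue (inv f ` box l u))"
    by (rule emeasure_eq_measure2[OF lm])
  also have "measure lebesgue (inv f ` box l u) = measure lebesgue (box l u)"
    by (rule measure_orthogonal_image[OF inv]) auto
  also have "\<dots> = (\<Prod>b\<in>Basis. (u - l) \<bullet> b)"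
    using le by (simp add: measure_lborel_box_eq)
  finally show "emeasure (distr lborel borel f) (box l u) = (\<Prod>b\<in>Basis. (u - l) \<bullet> b)" .
qed simp

lemma borel_measurable_vector_2:
  "(\<lambda>p. vector [fst p, snd p] :: real^2) \<in> borel_measurable (lborel \<Otimes>\<^sub>M lborel)"
proof -
  have "vector [s, t] = s *\<^sub>R axis 1 1 + t *\<^sub>R (axis 2 1 :: real^2)" for s t
    by (simp add: vec_eq_iff forall_2 axis_def)
  then have "continuous_on UNIV (\<lambda>p. vector [fst p, snd p] :: real^2)"
    by (simp add: continuous_intros)
  then show ?thesis
    unfolding lborel_prod by (simp add: borel_measurable_continuous_onI)
qed

text \<open>Preimages of boxes are products of intervals; this identifies the plane with a product
  space, where Tonelli applies.\<close>

lemma lborel_distr_vector_2: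
  "distr (lborel \<Otimes>\<^sub>M lborel) borel (\<lambda>p. vector [fst p, snd p] :: real^2) = lborel"
proof (rule sym, rule lborel_eqI)
  note borel_measurable_vector_2[measurable]
  fix l u :: "real^2"
  assume le: "\<And>b. b \<in> Basis \<Longrightarrow> l \<bullet> b \<le> u \<bullet> b"
  have vi: "(\<lambda>p. vector [fst p, snd p] :: real^2) -` box l u = box (l$1) (u$1) \<times> box (l$2) (u$2)"
    by (auto simp: mem_box_cart forall_2)
  have "emeasure (distr (lborel \<Otimes>\<^sub>M lborel) borel (\<lambda>p. vector [fst p, snd p] :: real^2)) (box l u) =
      emeasure (lborel \<Otimes>\<^sub>M lborel) (box (l$1) (u$1) \<times> box (l$2) (u$2))"
    by (simp add: emeasure_distr vi space_pair_measure)
  also have "\<dots> = emeasure lborel (box (l$1) (u$1)) * emeasure lborel (box (l$2) (u$2))"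
    by (simp add: lborel.emeasure_pair_measure_Times)
  also have "\<dots> = ennreal ((u$1 - l$1) * (u$2 - l$2))"
    using le[of "axis 1 1"] le[of "axis 2 1"] by (simp add: inner_axis ennreal_mult)
  also have "(u$1 - l$1) * (u$2 - l$2) = (\<Prod>b\<in>Basis. (u - l) \<bullet> b)"
    by (simp add: Basis_vec_def UNIV_2 inner_axis axis_eq_axis)
  finally show "emeasure (distr (lborel \<Otimes>\<^sub>M lborel) borel (\<lambda>p. vector [fst p, snd p] :: real^2)) (box l u)
    = (\<Prod>b\<in>Basis. (u - l) \<bullet> b)" .
qed simp

text \<open>The map \<open>T\<close> from standard to frame coordinates is orthogonal and hence
  preserves \<open>lborel\<close>; Tonelli in standard coordinates does the rest.\<close>

lemma nn_integral_orthonormal_frame: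
  fixes e e' :: "real^2"
  assumes e: "norm e = 1" "norm e' = 1" "e \<bullet> e' = 0"
    and [measurable]: "h \<in> borel_measurable borel"
  shows "(\<integral>\<^sup>+x. h x \<partial>lborel) = (\<integral>\<^sup>+s. \<integral>\<^sup>+t. h (s *\<^sub>R e + t *\<^sub>R e') \<partial>lborel \<partial>lborel)"
proof -
  define T :: "real^2 \<Rightarrow> real^2" where "T x = (x$1) *\<^sub>R e + (x$2) *\<^sub>R e'" for x
  have ee: "e \<bullet> e = 1" "e' \<bullet> e' = 1" "e' \<bullet> e = 0"
    using e by (simp_all add: dot_square_norm inner_commute)
  have T: "orthogonal_transformation T"
    unfolding orthogonal_transformation_def
  proof (intro conjI allI)
    show "linear T" by (rule linearI) (simp_all add: T_def algebra_simps)
    fix v w :: "real^2"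
    have "T v \<bullet> T w = v$1 * w$1 + v$2 * w$2"
      using e ee by (simp add: T_def inner_add_left inner_add_right)
    then show "T v \<bullet> T w = v \<bullet> w" by (simp add: inner_vec_def sum_2)
  qed
  have [measurable]: "T \<in> borel_measurable borel"
    using T by (intro borel_measurable_continuous_onI)
      (simp add: linear_continuous_on linear_linear orthogonal_transformation_linear)
  note borel_measurable_vector_2[measurable]
  have "(\<integral>\<^sup>+x. h x \<partial>lborel) = (\<integral>\<^sup>+x. h (T x) \<partial>lborel)"
    by (subst lborel_distr_orthogonal_transformation[OF T, symmetric]) (simp add: nn_integral_distr)
  also have "\<dots> = (\<integral>\<^sup>+p. h (T (vector [fst p, snd p])) \<partial>(lborel \<Otimes>\<^sub>M lborel))"
    by (subst lborel_distr_vector_2[symmetric]) (simp add: nn_integral_distr)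
  also have "\<dots> = (\<integral>\<^sup>+s. \<integral>\<^sup>+t. h (T (vector [s, t])) \<partial>lborel \<partial>lborel)"
    by (subst lborel.nn_integral_fst[symmetric]) simp_all
  finally show ?thesis by (simp add: T_def)
qed

section \<open>One-dimensional bounds in the form needed along segments, arcs and lines\<close>

lemma diff_square_le_nn_integral_subset:
  fixes g g' :: "real \<Rightarrow> real"
  assumes der: "\<And>t. (g has_real_derivative g' t) (at t)" and cont: "continuous_on UNIV g'"
    and "a \<in> {l..u}" "b \<in> {l..u}"
  shows "ennreal ((g b - g a)\<^sup>2) \<le> ennreal (u - l) * (\<integral>\<^sup>+t\<in>{l..u}. ennreal ((g' t)\<^sup>2) \<partial>lborel)"
  using assms(3,4)
proof (induction a b rule: linorder_wlog)
  case (le a b)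
  have "ennreal ((g b - g a)\<^sup>2) \<le> ennreal (b - a) * (\<integral>\<^sup>+t\<in>{a..b}. ennreal ((g' t)\<^sup>2) \<partial>lborel)"
    by (rule diff_square_le_nn_integral[OF der cont le(1)])
  also have "\<dots> \<le> ennreal (u - l) * (\<integral>\<^sup>+t\<in>{l..u}. ennreal ((g' t)\<^sup>2) \<partial>lborel)"
    using le by (intro mult_mono nn_integral_mono ennreal_leI) (auto simp: indicator_def)
  finally show ?case .
qed (simp add: power2_commute)

text \<open>The line is cut at \<open>0\<close> and each side is estimated from its own unit window
  inside \<open>{-1..1}\<close>; bounding both by the full window doubles the constants. The two
  shapes of \<open>I\<close> are those of a line that misses the disc and of a line stopped at the
  near side of the disc.\<close>

lemma gaussian_hardy_lessThan:
  fixes g g' :: "real \<Rightarrow> real"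
  assumes der: "\<And>t. (g has_real_derivative g' t) (at t)" and cont: "continuous_on UNIV g'"
    and I: "I = UNIV \<or> (\<exists>L>0. I = {..<L})"
  shows "(\<integral>\<^sup>+t\<in>I. ennreal ((g t)\<^sup>2 * exp (-t\<^sup>2)) \<partial>lborel)
    \<le> 10 * (\<integral>\<^sup>+t\<in>{-1..1}. ennreal ((g t)\<^sup>2 * exp (-t\<^sup>2)) \<partial>lborel)
      + 8 * (\<integral>\<^sup>+t\<in>I. ennreal ((g' t)\<^sup>2 * exp (-t\<^sup>2)) \<partial>lborel)"
proof -
  have "continuous_on UNIV g" using der DERIV_continuous_on by blast
  then have [measurable]: "g \<in> borel_measurable borel" "g' \<in> borel_measurable borel"
    using cont by (auto intro: borel_measurable_continuous_onI)
  have [measurable]: "I \<in> sets borel" using I by auto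
  define p where "p A = (\<integral>\<^sup>+t\<in>A. ennreal ((g t)\<^sup>2 * exp (-t\<^sup>2)) \<partial>lborel)" for A
  define q where "q A = (\<integral>\<^sup>+t\<in>A. ennreal ((g' t)\<^sup>2 * exp (-t\<^sup>2)) \<partial>lborel)" for A
  have mono: "p A \<le> p B" "q A \<le> q B" if "A \<subseteq> B" for A B
    unfolding p_def q_def using that by (auto intro!: nn_integral_mono simp: indicator_def)
  have neg: "p {..0} \<le> 5 * p {-1..0} + 4 * q {..0}"
    unfolding p_def q_def by (rule gaussian_hardy_atMost[OF der cont])
  have pos: "p (I \<inter> {0..}) \<le> 5 * p {0..1} + 4 * q (I \<inter> {0..})"
    using I
  proof
    assume "I = UNIV"
    then show ?thesis
      unfolding p_def q_def using gaussian_hardy_atLeast[OF der cont, of 0] by simp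
  next
    assume "\<exists>L>0. I = {..<L}"
    then obtain L where "I = {..<L}" by auto
    then have L: "I \<inter> {0..} = {0..<L}" by auto
    have "AE t in lborel. t \<noteq> L" by (rule AE_lborel_singleton)
    then have "q {0..<L} = q {0..L}"
      unfolding q_def by (intro nn_integral_cong_AE) (auto simp: indicator_def elim!: eventually_mono)
    then show ?thesis
      unfolding L using order_trans[OF mono(1)[of "{0..<L}" "{0..L}"]] gaussian_hardy_Icc[OF der cont, of 0 L]
      by (simp add: p_def q_def subset_eq)
  qed
  have "p I \<le> p (I \<inter> {0..}) + p {..0}"
    unfolding p_def by (subst nn_integral_add[symmetric]) (auto intro!: nn_integral_mono simp: indicator_def)
  also have "\<dots> \<le> (5 * p {0..1} + 4 * q (I \<inter> {0..})) + (5 * p {-1..0} + 4 * q {..0})"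
    by (rule add_mono[OF pos neg])
  \<comment> \<open>Here \<open>L > 0\<close> enters: it places \<open>{..0}\<close> inside
    \<open>I\<close>, so the energy on the negative side is part of \<open>q I\<close>.\<close>
  also have "\<dots> \<le> (5 * p {-1..1} + 4 * q I) + (5 * p {-1..1} + 4 * q I)"
    using I by (intro add_mono mult_left_mono mono) auto
  also have "\<dots> = (5 + 5) * p {-1..1} + (4 + 4) * q I"
    by (simp only: distrib_right add_ac)
  finally show ?thesis by (simp add: p_def q_def)
qed

section \<open>Gaussian mass and energy outside the disc\<close>

text \<open>The disc has center \<open>Y *\<^sub>R e\<close> and radius \<open>r\<close>;
  \<open>1 + r < Y\<close> separates it from the strip of half-width \<open>1\<close> about the
  origin. The abstract gradient \<open>D\<close> records exactly the first-order regularity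
  used.\<close>

locale obstacle_gradient =
  fixes f :: "real^2 \<Rightarrow> real" and D :: "real^2 \<Rightarrow> real^2" and e e' :: "real^2" and Y r :: real
  assumes frame: "norm e = 1" "norm e' = 1" "e \<bullet> e' = 0"
    and r: "0 \<le> r" "1 + r < Y"
    and der: "\<And>x. (f has_derivative (\<lambda>h. D x \<bullet> h)) (at x)"
    and contD: "continuous_on UNIV D"
begin

text \<open>Values in \<open>ennreal\<close> spare all integrability questions until the end, and
  the normalization of the measure is left out because it cancels.\<close>

definition mass :: "real \<Rightarrow> (real^2) set \<Rightarrow> ennreal" where
  "mass a S = (\<integral>\<^sup>+x\<in>S. ennreal ((f x - a)\<^sup>2 * exp (- (norm x)\<^sup>2)) \<partial>lborel)"

definition energy :: "(real^2) set \<Rightarrow> ennreal" where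
  "energy S = (\<integral>\<^sup>+x\<in>S. ennreal ((norm (D x))\<^sup>2 * exp (- (norm x)\<^sup>2)) \<partial>lborel)"

definition \<Omega> :: "(real^2) set" where
  "\<Omega> = {x. r < norm (x - Y *\<^sub>R e)}"

lemma contf: "continuous_on UNIV f"
  using der by (meson differentiable_at_imp_differentiable_on differentiable_def differentiable_imp_continuous_on)

lemma measurable_f[measurable]: "f \<in> borel_measurable borel"
  using contf by (rule borel_measurable_continuous_onI)

lemma measurable_D[measurable]: "D \<in> borel_measurable borel"
  using contD by (rule borel_measurable_continuous_onI)

lemma mass_mono: "S \<subseteq> T \<Longrightarrow> mass a S \<le> mass a T"
  unfolding mass_def by (auto intro!: nn_integral_mono simp: indicator_def)

lemma energy_mono: "S \<subseteq> T \<Longrightarrow> energy S \<le> energy T"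
  unfolding energy_def by (auto intro!: nn_integral_mono simp: indicator_def)

lemma mass_Un:
  assumes [measurable]: "S \<in> sets borel" "T \<in> sets borel"
  shows "mass a (S \<union> T) \<le> mass a S + mass a T"
  unfolding mass_def by (subst nn_integral_add[symmetric]) (auto intro!: nn_integral_mono simp: indicator_def)

lemma frame_inner: "e \<bullet> e = 1" "e' \<bullet> e' = 1" "e' \<bullet> e = 0" "e \<bullet> e' = 0"
  using frame by (simp_all add: dot_square_norm inner_commute)

lemma norm_frame: "(norm (s *\<^sub>R e + t *\<^sub>R e'))\<^sup>2 = s\<^sup>2 + t\<^sup>2"
  unfolding power2_norm_eq_inner
  by (simp add: inner_add_left inner_add_right frame_inner power2_eq_square)

lemma vec_eq_frame: "x = (x \<bullet> e) *\<^sub>R e + (x \<bullet> e') *\<^sub>R e'" (is "x = ?y")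
proof -
  have "\<exists>s t. x = s *\<^sub>R e + t *\<^sub>R e'"
  proof -
    \<comment> \<open>\<open>J\<close> is the determinant of the frame. Lagrange's identity gives
      \<open>J\<^sup>2 = 1\<close>, and Cramer's rule then yields the coefficients of
      \<open>x\<close>.\<close>
    define J where "J = e$1 * e'$2 - e$2 * e'$1"
    have sq: "(e$1)\<^sup>2 + (e$2)\<^sup>2 = 1" "(e'$1)\<^sup>2 + (e'$2)\<^sup>2 = 1" "e$1 * e'$1 + e$2 * e'$2 = 0"
      using frame_inner by (simp_all add: inner_vec_def sum_2 power2_eq_square)
    have "J\<^sup>2 = ((e$1)\<^sup>2 + (e$2)\<^sup>2) * ((e'$1)\<^sup>2 + (e'$2)\<^sup>2) - (e$1 * e'$1 + e$2 * e'$2)\<^sup>2"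
      by (simp add: J_def power2_eq_square algebra_simps)
    then have "J \<noteq> 0" using sq by auto
    then have "x = ((x$1 * e'$2 - x$2 * e'$1) / J) *\<^sub>R e + ((x$2 * e$1 - x$1 * e$2) / J) *\<^sub>R e'"
      by (simp add: vec_eq_iff forall_2 divide_simps) (simp add: J_def algebra_simps)
    then show ?thesis by blast
  qed
  then show ?thesis by (auto simp: inner_add_left frame_inner)
qed

lemma norm_obstacle: "(norm (x - Y *\<^sub>R e))\<^sup>2 = (x \<bullet> e - Y)\<^sup>2 + (x \<bullet> e')\<^sup>2"
proof -
  have "x - Y *\<^sub>R e = (x \<bullet> e - Y) *\<^sub>R e + (x \<bullet> e') *\<^sub>R e'"
    by (subst vec_eq_frame) (simp add: algebra_simps)
  then show ?thesis by (metis norm_frame)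
qed

lemma mem_\<Omega>: "x \<in> \<Omega> \<longleftrightarrow> r\<^sup>2 < (x \<bullet> e - Y)\<^sup>2 + (x \<bullet> e')\<^sup>2"
  using r unfolding \<Omega>_def norm_obstacle[symmetric] by (auto simp: abs_le_square_iff simp flip: not_le)

lemma der_line: "((\<lambda>s. f (t *\<^sub>R v + s *\<^sub>R u) - a) has_real_derivative (D (t *\<^sub>R v + s *\<^sub>R u) \<bullet> u)) (at s)"
proof -
  have "((\<lambda>s. t *\<^sub>R v + s *\<^sub>R u) has_derivative (\<lambda>h. h *\<^sub>R u)) (at s)"
    by (auto intro!: derivative_eq_intros)
  from has_derivative_compose[OF this der]
  have "((\<lambda>s. f (t *\<^sub>R v + s *\<^sub>R u) - a) has_derivative (\<lambda>h. D (t *\<^sub>R v + s *\<^sub>R u) \<bullet> h *\<^sub>R u)) (at s)"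
    by (auto intro!: derivative_eq_intros)
  then show ?thesis by (simp add: has_field_derivative_def mult_commute_abs)
qed

lemma cont_line: "continuous_on UNIV (\<lambda>s. D (t *\<^sub>R v + s *\<^sub>R u) \<bullet> u)"
  by (intro continuous_intros continuous_on_compose2[OF contD]) auto

text \<open>The Gaussian factorizes as \<open>exp (-t\<^sup>2) * exp (-s\<^sup>2)\<close>. An
  inequality on every line parallel to \<open>u\<close>, with constants independent of the line, can
  therefore be integrated against \<open>exp (-t\<^sup>2)\<close>; the derivative along the unit
  vector \<open>u\<close> is at most the norm of the gradient.\<close>

lemma mass_le_slices:
  assumes uv: "norm u = 1" "norm v = 1" "v \<bullet> u = 0"
    and [measurable]: "S \<in> sets borel" "T \<in> sets borel" "R \<in> sets borel"
    and slice: "\<And>t. (\<integral>\<^sup>+s\<in>{s. t *\<^sub>R v + s *\<^sub>R u \<in> S}. ennreal ((f (t *\<^sub>R v + s *\<^sub>R u) - a)\<^sup>2 * exp (-s\<^sup>2)) \<partial>lborel)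
      \<le> c * (\<integral>\<^sup>+s\<in>{s. t *\<^sub>R v + s *\<^sub>R u \<in> T}. ennreal ((f (t *\<^sub>R v + s *\<^sub>R u) - a)\<^sup>2 * exp (-s\<^sup>2)) \<partial>lborel)
        + d * (\<integral>\<^sup>+s\<in>{s. t *\<^sub>R v + s *\<^sub>R u \<in> R}. ennreal ((D (t *\<^sub>R v + s *\<^sub>R u) \<bullet> u)\<^sup>2 * exp (-s\<^sup>2)) \<partial>lborel)"
  shows "mass a S \<le> c * mass a T + d * energy R"
proof -
  let ?p = "\<lambda>t s. t *\<^sub>R v + s *\<^sub>R u"
  have uv': "u \<bullet> u = 1" "v \<bullet> v = 1" "u \<bullet> v = 0"
    using uv by (simp_all add: dot_square_norm inner_commute)
  have n: "(norm (?p t s))\<^sup>2 = s\<^sup>2 + t\<^sup>2" for s t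
    unfolding power2_norm_eq_inner
    by (simp add: inner_add_left inner_add_right uv uv' power2_eq_square)
  have ex: "ennreal (h * exp (- (norm (?p t s))\<^sup>2)) * i = ennreal (exp (-t\<^sup>2)) * (ennreal (h * exp (-s\<^sup>2)) * i)"
    if "0 \<le> h" for h s t i
  proof -
    have "ennreal (h * exp (- (norm (?p t s))\<^sup>2)) = ennreal (exp (-t\<^sup>2)) * ennreal (h * exp (-s\<^sup>2))"
      using that by (subst ennreal_mult[symmetric]) (auto simp: n exp_add[symmetric] mult_ac)
    then show ?thesis by (simp add: mult.assoc)
  qed
  have sl: "(\<integral>\<^sup>+x\<in>S. ennreal (h x * exp (- (norm x)\<^sup>2)) \<partial>lborel) =
     (\<integral>\<^sup>+t. ennreal (exp (-t\<^sup>2)) * (\<integral>\<^sup>+s\<in>{s. ?p t s \<in> S}. ennreal (h (?p t s) * exp (-s\<^sup>2)) \<partial>lborel) \<partial>lborel)"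
    if [measurable]: "h \<in> borel_measurable borel" "S \<in> sets borel" and "\<And>x. 0 \<le> h x" for h S
  proof -
    have "(\<integral>\<^sup>+x\<in>S. ennreal (h x * exp (- (norm x)\<^sup>2)) \<partial>lborel) =
      (\<integral>\<^sup>+t. \<integral>\<^sup>+s. ennreal (h (?p t s) * exp (- (norm (?p t s))\<^sup>2)) * indicator S (?p t s) \<partial>lborel \<partial>lborel)"
      using uv by (subst nn_integral_orthonormal_frame[of v u]) simp_all
    also have "\<dots> = (\<integral>\<^sup>+t. \<integral>\<^sup>+s. ennreal (exp (-t\<^sup>2)) * (ennreal (h (?p t s) * exp (-s\<^sup>2)) * indicator S (?p t s)) \<partial>lborel \<partial>lborel)"
      using that(3) by (simp add: ex)
    also have "\<dots> = (\<integral>\<^sup>+t. ennreal (exp (-t\<^sup>2)) * (\<integral>\<^sup>+s. ennreal (h (?p t s) * exp (-s\<^sup>2)) * indicator S (?p t s) \<partial>lborel) \<partial>lborel)"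
      by (simp add: nn_integral_cmult)
    finally show ?thesis by (simp add: indicator_def)
  qed
  let ?m = "\<lambda>S t. \<integral>\<^sup>+s. ennreal ((f (?p t s) - a)\<^sup>2 * exp (-s\<^sup>2)) * indicator S (?p t s) \<partial>lborel"
  let ?d = "\<lambda>t. \<integral>\<^sup>+s. ennreal ((norm (D (?p t s)))\<^sup>2 * exp (-s\<^sup>2)) * indicator R (?p t s) \<partial>lborel"
  have ind: "indicator {s. ?p t s \<in> S} s = (indicator S (?p t s) :: ennreal)" for s t S
    by (simp add: indicator_def)
  have dle: "(\<integral>\<^sup>+s\<in>{s. ?p t s \<in> R}. ennreal ((D (?p t s) \<bullet> u)\<^sup>2 * exp (-s\<^sup>2)) \<partial>lborel) \<le> ?d t" for t
  proof -
    have "(D x \<bullet> u)\<^sup>2 \<le> (norm (D x))\<^sup>2" for x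
      using Cauchy_Schwarz_ineq2[of "D x" u] uv by (simp add: abs_le_square_iff[symmetric])
    then show ?thesis unfolding ind
      by (intro nn_integral_mono mult_right_mono ennreal_leI) auto
  qed
  have m: "mass a S = (\<integral>\<^sup>+t. ennreal (exp (-t\<^sup>2)) * ?m S t \<partial>lborel)" if [measurable]: "S \<in> sets borel" for S
    unfolding mass_def by (subst sl) (simp_all add: ind)
  have en: "energy R = (\<integral>\<^sup>+t. ennreal (exp (-t\<^sup>2)) * ?d t \<partial>lborel)"
    unfolding energy_def by (subst sl) (simp_all add: ind)
  have "mass a S \<le> (\<integral>\<^sup>+t. ennreal (exp (-t\<^sup>2)) * (c * ?m T t + d * ?d t) \<partial>lborel)"
    unfolding m[OF assms(4)]
    by (intro nn_integral_mono mult_left_mono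
      order_trans[OF slice[unfolded ind] add_left_mono[OF mult_left_mono[OF dle[unfolded ind]]]]) auto
  also have "\<dots> = (\<integral>\<^sup>+t. c * (ennreal (exp (-t\<^sup>2)) * ?m T t) + d * (ennreal (exp (-t\<^sup>2)) * ?d t) \<partial>lborel)"
    by (simp add: distrib_left mult_ac)
  also have "\<dots> = c * mass a T + d * energy R"
    unfolding m[OF assms(5)] en by (subst nn_integral_add) (simp_all add: nn_integral_cmult)
  finally show ?thesis .
qed

section \<open>Decomposition of the complement of the disc\<close>

definition Q :: "(real^2) set" where
  "Q = {x. \<bar>x \<bullet> e\<bar> \<le> 1 \<and> \<bar>x \<bullet> e'\<bar> \<le> 1}"

definition V :: "(real^2) set" where
  "V = {x. \<bar>x \<bullet> e\<bar> \<le> 1}"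

text \<open>
  The guard \<open>\<bar>x \<bullet> e'\<bar> \<le> r\<close> matters: \<open>sqrt\<close> takes negative values at negative arguments.
\<close>

definition front :: "(real^2) set" where
  "front = {x. \<bar>x \<bullet> e'\<bar> \<le> r \<longrightarrow> x \<bullet> e < Y - sqrt (r\<^sup>2 - (x \<bullet> e')\<^sup>2)}"

definition shadow :: "(real^2) set" where
  "shadow = {x. \<bar>x \<bullet> e'\<bar> \<le> r \<and> Y + sqrt (r\<^sup>2 - (x \<bullet> e')\<^sup>2) < x \<bullet> e}"

text \<open>The far half of the annulus of width \<open>1\<close> around the disc. Being described
  by the distance to the center, it stays outside the disc under every rotation about that
  center.\<close>

definition cap :: "(real^2) set" where
  "cap = {x. Y < x \<bullet> e \<and> r < norm (x - Y *\<^sub>R e) \<and> norm (x - Y *\<^sub>R e) < r + 1}"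

lemma measurable_sets[measurable]:
  "Q \<in> sets borel" "V \<in> sets borel" "front \<in> sets borel" "shadow \<in> sets borel" "cap \<in> sets borel"
  "\<Omega> \<in> sets borel"
  unfolding Q_def V_def front_def shadow_def cap_def \<Omega>_def by measurable

lemma V_subset: "V \<subseteq> \<Omega>"
proof
  fix x assume "x \<in> V"
  then have "r < Y - x \<bullet> e" using r by (auto simp: V_def)
  then have "r\<^sup>2 < (Y - x \<bullet> e)\<^sup>2" using r by (intro power_strict_mono) auto
  moreover have "0 \<le> (x \<bullet> e')\<^sup>2" by simp
  ultimately have "r\<^sup>2 < (Y - x \<bullet> e)\<^sup>2 + (x \<bullet> e')\<^sup>2" by linarith
  then show "x \<in> \<Omega>" by (simp add: mem_\<Omega> power2_commute[of "x \<bullet> e"])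
qed

lemma Q_subset: "Q \<subseteq> V" by (auto simp: Q_def V_def)

lemma outside_iff:
  assumes "\<bar>t\<bar> \<le> r"
  shows "r\<^sup>2 < s\<^sup>2 + t\<^sup>2 \<longleftrightarrow> sqrt (r\<^sup>2 - t\<^sup>2) < \<bar>s\<bar>"
proof -
  have "sqrt (r\<^sup>2 - t\<^sup>2) < \<bar>s\<bar> \<longleftrightarrow> sqrt (r\<^sup>2 - t\<^sup>2) < sqrt (s\<^sup>2)" by simp
  also have "\<dots> \<longleftrightarrow> r\<^sup>2 < s\<^sup>2 + t\<^sup>2" unfolding real_sqrt_less_iff by auto
  finally show ?thesis by simp
qed

lemma root_nonneg: "\<bar>t\<bar> \<le> r \<Longrightarrow> 0 \<le> sqrt (r\<^sup>2 - t\<^sup>2)"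
  using r by (simp add: abs_le_square_iff[symmetric])

lemma root_le: "sqrt (r\<^sup>2 - t\<^sup>2) \<le> r"
  using r by (intro real_le_lsqrt) auto

lemma outside_wide: "r < \<bar>t\<bar> \<Longrightarrow> r\<^sup>2 < s\<^sup>2 + t\<^sup>2"
  using r power_strict_mono[of r "\<bar>t\<bar>" 2] by (simp add: add_strict_increasing2)

lemma front_subset: "front \<subseteq> \<Omega>"
  using outside_iff outside_wide by (fastforce simp: front_def mem_\<Omega> not_le)

lemma shadow_subset: "shadow \<subseteq> \<Omega>"
  using outside_iff by (fastforce simp: shadow_def mem_\<Omega>)

lemma \<Omega>_subset: "\<Omega> \<subseteq> front \<union> shadow"
proof
  fix x assume "x \<in> \<Omega>"
  then have *: "r\<^sup>2 < (x \<bullet> e - Y)\<^sup>2 + (x \<bullet> e')\<^sup>2" by (simp add: mem_\<Omega>)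
  show "x \<in> front \<union> shadow"
  proof (cases "\<bar>x \<bullet> e'\<bar> \<le> r")
    case True
    with * show ?thesis by (auto simp: outside_iff front_def shadow_def)
  qed (simp add: front_def)
qed

section \<open>Mass estimates on the strip, the front, the shadow and the square\<close>

lemma frame_coordinates:
  "(s *\<^sub>R e + t *\<^sub>R e') \<bullet> e = s" "(s *\<^sub>R e + t *\<^sub>R e') \<bullet> e' = t"
  "(t *\<^sub>R e' + s *\<^sub>R e) \<bullet> e = s" "(t *\<^sub>R e' + s *\<^sub>R e) \<bullet> e' = t"
  by (simp_all add: inner_add_left frame_inner)

text \<open>Slices in direction \<open>e'\<close> are either empty or full lines, and on the latter
  the window \<open>{-1..1}\<close> is the slice of \<open>Q\<close>.\<close>

lemma mass_V: "mass a V \<le> 10 * mass a Q + 8 * energy V"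
proof (rule mass_le_slices)
  fix t
  show "(\<integral>\<^sup>+s\<in>{s. t *\<^sub>R e + s *\<^sub>R e' \<in> V}. ennreal ((f (t *\<^sub>R e + s *\<^sub>R e') - a)\<^sup>2 * exp (-s\<^sup>2)) \<partial>lborel)
      \<le> 10 * (\<integral>\<^sup>+s\<in>{s. t *\<^sub>R e + s *\<^sub>R e' \<in> Q}. ennreal ((f (t *\<^sub>R e + s *\<^sub>R e') - a)\<^sup>2 * exp (-s\<^sup>2)) \<partial>lborel)
        + 8 * (\<integral>\<^sup>+s\<in>{s. t *\<^sub>R e + s *\<^sub>R e' \<in> V}. ennreal ((D (t *\<^sub>R e + s *\<^sub>R e') \<bullet> e')\<^sup>2 * exp (-s\<^sup>2)) \<partial>lborel)"
  proof (cases "\<bar>t\<bar> \<le> 1")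
    case True
    then have "{s. t *\<^sub>R e + s *\<^sub>R e' \<in> V} = UNIV" "{s. t *\<^sub>R e + s *\<^sub>R e' \<in> Q} = {-1..1}"
      by (auto simp: V_def Q_def frame_coordinates)
    then show ?thesis
      using gaussian_hardy_lessThan[OF der_line cont_line, of UNIV t e e' a] by simp
  qed (simp add: V_def frame_coordinates)
qed (use frame frame_inner in simp_all)

text \<open>Slices in direction \<open>e\<close> are full lines or end at the circle at height
  \<open>Y - sqrt (r\<^sup>2 - t\<^sup>2) \<ge> Y - r > 0\<close>; on each of them the window
  \<open>{-1..1}\<close> is the slice of \<open>V\<close>.\<close>

lemma mass_front: "mass a front \<le> 10 * mass a V + 8 * energy front"
proof (rule mass_le_slices)
  fix t
  let ?I = "{s. t *\<^sub>R e' + s *\<^sub>R e \<in> front}"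
  have "?I = UNIV \<or> (\<exists>L>0. ?I = {..<L})"
  proof (cases "\<bar>t\<bar> \<le> r")
    case True
    then have "?I = {..<Y - sqrt (r\<^sup>2 - t\<^sup>2)}"
      by (auto simp: front_def frame_coordinates)
    moreover have "0 < Y - sqrt (r\<^sup>2 - t\<^sup>2)" using root_le[of t] r by linarith
    ultimately show ?thesis by blast
  qed (simp add: front_def frame_coordinates)
  moreover have "{s. t *\<^sub>R e' + s *\<^sub>R e \<in> V} = {-1..1}"
    by (auto simp: V_def frame_coordinates)
  ultimately show "(\<integral>\<^sup>+s\<in>?I. ennreal ((f (t *\<^sub>R e' + s *\<^sub>R e) - a)\<^sup>2 * exp (-s\<^sup>2)) \<partial>lborel)
      \<le> 10 * (\<integral>\<^sup>+s\<in>{s. t *\<^sub>R e' + s *\<^sub>R e \<in> V}. ennreal ((f (t *\<^sub>R e' + s *\<^sub>R e) - a)\<^sup>2 * exp (-s\<^sup>2)) \<partial>lborel)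
        + 8 * (\<integral>\<^sup>+s\<in>?I. ennreal ((D (t *\<^sub>R e' + s *\<^sub>R e) \<bullet> e)\<^sup>2 * exp (-s\<^sup>2)) \<partial>lborel)"
    using gaussian_hardy_lessThan[OF der_line cont_line, of ?I t e' e a] by simp
qed (use frame frame_inner in simp_all)

text \<open>Slices in direction \<open>e\<close> are half-lines that leave the far side of the
  circle, and their first unit interval lies in \<open>cap\<close>. The starting point depends on
  \<open>t\<close>, which is harmless because the Hardy constants do not depend on it.\<close>

lemma mass_shadow: "mass a shadow \<le> 5 * mass a cap + 4 * energy shadow"
proof (rule mass_le_slices)
  fix t
  let ?p = "\<lambda>s. t *\<^sub>R e' + s *\<^sub>R e"
  let ?m = "Y + sqrt (r\<^sup>2 - t\<^sup>2)"
  \<comment> \<open>The Hardy inequality uses closed intervals, whereas slices of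
    \<open>shadow\<close> and \<open>cap\<close> omit the end points; these two points are
    null.\<close>
  have ae: "AE s in lborel. s \<noteq> ?m \<and> s \<noteq> ?m + 1"
    using AE_lborel_singleton[of ?m] AE_lborel_singleton[of "?m + 1"] by eventually_elim simp
  show "(\<integral>\<^sup>+s\<in>{s. ?p s \<in> shadow}. ennreal ((f (?p s) - a)\<^sup>2 * exp (-s\<^sup>2)) \<partial>lborel)
      \<le> 5 * (\<integral>\<^sup>+s\<in>{s. ?p s \<in> cap}. ennreal ((f (?p s) - a)\<^sup>2 * exp (-s\<^sup>2)) \<partial>lborel)
        + 4 * (\<integral>\<^sup>+s\<in>{s. ?p s \<in> shadow}. ennreal ((D (?p s) \<bullet> e)\<^sup>2 * exp (-s\<^sup>2)) \<partial>lborel)"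
  proof (cases "\<bar>t\<bar> \<le> r")
    case True
    have I: "{s. ?p s \<in> shadow} = {?m<..}"
      using True by (auto simp: shadow_def frame_coordinates)
    \<comment> \<open>With \<open>?h\<^sup>2 + t\<^sup>2 = r\<^sup>2\<close> and
      \<open>?h \<le> r\<close>, a step of length below \<open>1\<close> from the circle in
      direction \<open>e\<close> raises the distance to the center by less than
      \<open>1\<close>.\<close>
    have cap: "?p s \<in> cap" if "?m < s" "s < ?m + 1" for s
    proof -
      let ?h = "sqrt (r\<^sup>2 - t\<^sup>2)"
      have n: "(norm (?p s - Y *\<^sub>R e))\<^sup>2 = (s - Y)\<^sup>2 + t\<^sup>2"
        by (simp add: norm_obstacle frame_coordinates)
      have h: "0 \<le> ?h" "?h \<le> r" using root_nonneg[OF True] root_le by auto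
      have h2: "?h\<^sup>2 = r\<^sup>2 - t\<^sup>2" using h by simp
      have sY: "Y < s" using that(1) h(1) by linarith
      then have "(s - Y)\<^sup>2 < (?h + 1)\<^sup>2" using that by (intro power_strict_mono) auto
      also have "\<dots> = ?h\<^sup>2 + 2 * ?h + 1" by (simp add: power2_sum)
      also have "\<dots> \<le> (r + 1)\<^sup>2 - t\<^sup>2" using h(2) unfolding h2 by (simp add: power2_sum)
      finally have "(norm (?p s - Y *\<^sub>R e))\<^sup>2 < (r + 1)\<^sup>2" by (simp add: n)
      then have "norm (?p s - Y *\<^sub>R e) < r + 1" using r by (auto intro: power2_less_imp_less)
      moreover have "?p s \<in> shadow" using that(1) I by blast
      then have "?p s \<in> \<Omega>" using shadow_subset by blast
      ultimately show ?thesis using sY by (simp add: cap_def \<Omega>_def frame_coordinates)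
    qed
    have "(\<integral>\<^sup>+s\<in>{s. ?p s \<in> shadow}. ennreal ((f (?p s) - a)\<^sup>2 * exp (-s\<^sup>2)) \<partial>lborel)
        \<le> (\<integral>\<^sup>+s\<in>{?m..}. ennreal ((f (?p s) - a)\<^sup>2 * exp (-s\<^sup>2)) \<partial>lborel)"
      unfolding I by (intro nn_integral_mono) (auto simp: indicator_def)
    also have "\<dots> \<le> 5 * (\<integral>\<^sup>+s\<in>{?m..?m+1}. ennreal ((f (?p s) - a)\<^sup>2 * exp (-s\<^sup>2)) \<partial>lborel)
        + 4 * (\<integral>\<^sup>+s\<in>{?m..}. ennreal ((D (?p s) \<bullet> e)\<^sup>2 * exp (-s\<^sup>2)) \<partial>lborel)"
      by (rule gaussian_hardy_atLeast[OF der_line cont_line]) (use r root_nonneg[OF True] in linarith)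
    also have "\<dots> \<le> 5 * (\<integral>\<^sup>+s\<in>{s. ?p s \<in> cap}. ennreal ((f (?p s) - a)\<^sup>2 * exp (-s\<^sup>2)) \<partial>lborel)
        + 4 * (\<integral>\<^sup>+s\<in>{s. ?p s \<in> shadow}. ennreal ((D (?p s) \<bullet> e)\<^sup>2 * exp (-s\<^sup>2)) \<partial>lborel)"
      unfolding I
    proof (rule add_mono; rule mult_left_mono)
      have i: "indicator {?m..?m+1} s \<le> (indicator {s. ?p s \<in> cap} s :: ennreal)"
        if "s \<noteq> ?m \<and> s \<noteq> ?m + 1" for s
        using that cap[of s] by (cases "s \<in> {?m..?m+1}") (simp_all add: less_le)
      show "(\<integral>\<^sup>+s\<in>{?m..?m+1}. ennreal ((f (?p s) - a)\<^sup>2 * exp (-s\<^sup>2)) \<partial>lborel)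
          \<le> (\<integral>\<^sup>+s\<in>{s. ?p s \<in> cap}. ennreal ((f (?p s) - a)\<^sup>2 * exp (-s\<^sup>2)) \<partial>lborel)"
        by (intro nn_integral_mono_AE eventually_mono[OF ae] mult_left_mono i) simp_all
      have i: "indicator {?m..} s \<le> (indicator {?m<..} s :: ennreal)" if "s \<noteq> ?m \<and> s \<noteq> ?m + 1" for s
        using that by (cases "s \<in> {?m..}") (simp_all add: less_le)
      show "(\<integral>\<^sup>+s\<in>{?m..}. ennreal ((D (?p s) \<bullet> e)\<^sup>2 * exp (-s\<^sup>2)) \<partial>lborel)
          \<le> (\<integral>\<^sup>+s\<in>{?m<..}. ennreal ((D (?p s) \<bullet> e)\<^sup>2 * exp (-s\<^sup>2)) \<partial>lborel)"
        by (intro nn_integral_mono_AE eventually_mono[OF ae] mult_left_mono i) simp_all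
    qed simp_all
    finally show ?thesis .
  qed (simp add: shadow_def frame_coordinates)
qed (use frame frame_inner in simp_all)

text \<open>Each point of the square is joined to one base point by a horizontal segment followed by
  a piece of a fixed vertical segment of small energy. Integrating the pointwise bound
  \<open>4 * H t + 4 * I\<close> over the square of side \<open>2\<close> gives
  \<open>8 + 16 = 24\<close> times \<open>I\<close>; the factor \<open>exp 2\<close> compensates the
  weight, which lies between \<open>exp (-2)\<close> and \<open>1\<close> on
  \<open>Q\<close>.\<close>

lemma square_poincare:
  shows "\<exists>a. mass a Q \<le> ennreal (24 * exp 2) * energy Q"
proof -
  define G where "G x = ennreal ((norm (D x))\<^sup>2)" for x
  have [measurable]: "G \<in> borel_measurable borel" unfolding G_def by measurable
  let ?p = "\<lambda>s t. s *\<^sub>R e + t *\<^sub>R e'"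
  define h where "h s = (\<integral>\<^sup>+t\<in>{-1..1}. G (?p s t) \<partial>lborel)" for s
  define H where "H t = (\<integral>\<^sup>+s\<in>{-1..1}. G (?p s t) \<partial>lborel)" for t
  define I where "I = (\<integral>\<^sup>+x\<in>Q. G x \<partial>lborel)"
  have [measurable]: "h \<in> borel_measurable borel" "H \<in> borel_measurable borel"
    unfolding h_def H_def by measurable
  have ind: "(indicator Q (?p s t) :: ennreal) = indicator {-1..1} s * indicator {-1..1} t"
    "(indicator Q (t *\<^sub>R e' + s *\<^sub>R e) :: ennreal) = indicator {-1..1} s * indicator {-1..1} t" for s t
    by (auto simp: Q_def frame_coordinates indicator_def)
  have "I = (\<integral>\<^sup>+s. \<integral>\<^sup>+t. G (?p s t) * indicator Q (?p s t) \<partial>lborel \<partial>lborel)"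
    unfolding I_def by (rule nn_integral_orthonormal_frame[OF frame]) measurable
  also have "\<dots> = (\<integral>\<^sup>+s. \<integral>\<^sup>+t. G (?p s t) * indicator {-1..1} t * indicator {-1..1} s \<partial>lborel \<partial>lborel)"
    by (simp only: ind(1) mult_ac)
  also have "\<dots> = (\<integral>\<^sup>+s\<in>{-1..1}. h s \<partial>lborel)"
    unfolding h_def by (intro nn_integral_cong nn_integral_multc) measurable
  finally have Ih: "I = (\<integral>\<^sup>+s\<in>{-1..1}. h s \<partial>lborel)" .
  have "I = (\<integral>\<^sup>+t. \<integral>\<^sup>+s. G (t *\<^sub>R e' + s *\<^sub>R e) * indicator Q (t *\<^sub>R e' + s *\<^sub>R e) \<partial>lborel \<partial>lborel)"
    unfolding I_def by (rule nn_integral_orthonormal_frame[OF frame(2,1) frame_inner(3)]) measurable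
  also have "\<dots> = (\<integral>\<^sup>+t. \<integral>\<^sup>+s. G (?p s t) * indicator {-1..1} s * indicator {-1..1} t \<partial>lborel \<partial>lborel)"
    by (simp only: ind(2) mult_ac add.commute)
  also have "\<dots> = (\<integral>\<^sup>+t\<in>{-1..1}. H t \<partial>lborel)"
    unfolding H_def by (intro nn_integral_cong nn_integral_multc) measurable
  finally have IH: "I = (\<integral>\<^sup>+t\<in>{-1..1}. H t \<partial>lborel)" .
  \<comment> \<open>A vertical segment whose energy does not exceed that of the square; \<open>a\<close> is the value of \<open>f\<close> at its midpoint.\<close>
  have "\<exists>s0\<in>{-1..1}. h s0 \<le> I"
  proof (rule ccontr)
    assume "\<not> ?thesis"
    then have gt: "I < h s" if "s \<in> {-1..1}" for s using that by (auto simp: not_le)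
    \<comment> \<open>Averaging over an interval of length \<open>2\<close> would give
      \<open>2 * I \<le> I\<close>. Finiteness then forces \<open>I = 0\<close>, so \<open>h\<close>
      vanishes almost everywhere on the interval, contradicting \<open>I < h s\<close>.\<close>
    have fin: "I < \<top>" using gt[of 0] by (auto intro: less_le_trans)
    have "2 * I = (\<integral>\<^sup>+s\<in>{-1..1::real}. I \<partial>lborel)"
      by (subst nn_integral_cmult_indicator) (auto simp: mult.commute)
    also have "\<dots> \<le> I"
      unfolding Ih[symmetric] by (subst (2) Ih) (auto intro!: nn_integral_mono simp: indicator_def less_imp_le gt)
    finally have "I = 0" using fin
      by (cases I) (auto simp: ennreal_mult[symmetric] simp flip: ennreal_numeral)
    then have "AE s in lborel. h s * indicator {-1..1} s = 0"
      using Ih nn_integral_0_iff_AE[of "\<lambda>s. h s * indicator {-1..1} s" lborel] by simp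
    then have "AE s in lborel. s \<notin> {-1..1::real}"
      by eventually_elim (use gt not_less_zero in \<open>fastforce simp: indicator_def split: if_splits\<close>)
    then have "emeasure lborel {-1..1::real} = 0"
      by (subst (asm) AE_iff_measurable[of "{-1..1}"]) auto
    then show False by simp
  qed
  then obtain s0 where s0: "s0 \<in> {-1..1}" "h s0 \<le> I" by blast
  define a where "a = f (?p s0 0)"
  have le_norm: "(D x \<bullet> u)\<^sup>2 \<le> (norm (D x))\<^sup>2" if "norm u = 1" for x u
    using Cauchy_Schwarz_ineq2[of "D x" u] that by (simp add: abs_le_square_iff[symmetric])
  have pt: "ennreal ((f (?p s t) - a)\<^sup>2) \<le> 4 * H t + 4 * I" if st: "s \<in> {-1..1}" "t \<in> {-1..1}" for s t
  proof -
    have 1: "ennreal ((f (?p s t) - f (?p s0 t))\<^sup>2) \<le> 2 * H t"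
    proof -
      have "ennreal ((f (?p s t) - f (?p s0 t))\<^sup>2)
          \<le> ennreal (1 - (-1)) * (\<integral>\<^sup>+s\<in>{-1..1}. ennreal ((D (t *\<^sub>R e' + s *\<^sub>R e) \<bullet> e)\<^sup>2) \<partial>lborel)"
        using diff_square_le_nn_integral_subset[OF der_line cont_line s0(1) st(1), of t e' e 0]
        by (simp add: add.commute)
      also have "\<dots> \<le> 2 * H t"
        unfolding H_def G_def using frame
        by (auto intro!: mult_mono nn_integral_mono ennreal_leI le_norm simp: add.commute)
      finally show ?thesis .
    qed
    have 2: "ennreal ((f (?p s0 t) - a)\<^sup>2) \<le> 2 * I"
    proof -
      have "ennreal ((f (?p s0 t) - a)\<^sup>2)
          \<le> ennreal (1 - (-1)) * (\<integral>\<^sup>+t\<in>{-1..1}. ennreal ((D (?p s0 t) \<bullet> e')\<^sup>2) \<partial>lborel)"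
        using diff_square_le_nn_integral_subset[OF der_line cont_line _ st(2), of 0 s0 e e' 0]
        by (simp add: a_def)
      also have "\<dots> \<le> 2 * h s0"
        unfolding h_def G_def using frame
        by (auto intro!: mult_mono nn_integral_mono ennreal_leI le_norm)
      also have "\<dots> \<le> 2 * I" by (intro mult_left_mono s0) simp
      finally show ?thesis .
    qed
    have "(f (?p s t) - a)\<^sup>2 \<le> 2 * (f (?p s t) - f (?p s0 t))\<^sup>2 + 2 * (f (?p s0 t) - a)\<^sup>2"
      using zero_le_power2[of "(f (?p s t) - f (?p s0 t)) - (f (?p s0 t) - a)"]
      by (simp add: power2_eq_square algebra_simps)
    then have "ennreal ((f (?p s t) - a)\<^sup>2)
       \<le> 2 * ennreal ((f (?p s t) - f (?p s0 t))\<^sup>2) + 2 * ennreal ((f (?p s0 t) - a)\<^sup>2)"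
      by (simp add: ennreal_mult[symmetric] ennreal_plus[symmetric] ennreal_leI
           del: ennreal_plus flip: ennreal_numeral)
    also have "\<dots> \<le> 2 * (2 * H t) + 2 * (2 * I)"
      by (intro add_mono mult_left_mono 1 2) auto
    finally show ?thesis by (simp add: mult.assoc[symmetric])
  qed
  have "mass a Q \<le> (\<integral>\<^sup>+x\<in>Q. ennreal ((f x - a)\<^sup>2) \<partial>lborel)"
    unfolding mass_def
    by (intro nn_integral_mono mult_right_mono ennreal_leI) (auto intro: mult_left_le)
  also have "\<dots> = (\<integral>\<^sup>+s. \<integral>\<^sup>+t. ennreal ((f (?p s t) - a)\<^sup>2) * (indicator {-1..1} s * indicator {-1..1} t) \<partial>lborel \<partial>lborel)"
    using frame by (subst nn_integral_orthonormal_frame[of e e']) (simp_all add: ind)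
  also have "\<dots> \<le> (\<integral>\<^sup>+s. \<integral>\<^sup>+t. (4 * H t + 4 * I) * (indicator {-1..1::real} s * indicator {-1..1} t) \<partial>lborel \<partial>lborel)"
    by (intro nn_integral_mono) (auto simp: indicator_def pt)
  also have "\<dots> = (\<integral>\<^sup>+s. indicator {-1..1::real} s * (4 * I + 4 * I * 2) \<partial>lborel)"
  proof (rule nn_integral_cong)
    fix s :: real
    have "(\<integral>\<^sup>+t. (4 * H t + 4 * I) * (indicator {-1..1} s * indicator {-1..1} t) \<partial>lborel)
        = (\<integral>\<^sup>+t. indicator {-1..1} s * (4 * (H t * indicator {-1..1} t) + 4 * I * indicator {-1..1} t) \<partial>lborel)"
      by (rule nn_integral_cong) (simp add: indicator_def)
    also have "\<dots> = indicator {-1..1} s * (\<integral>\<^sup>+t. 4 * (H t * indicator {-1..1} t) + 4 * I * indicator {-1..1} t \<partial>lborel)"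
      by (rule nn_integral_cmult) measurable
    also have "(\<integral>\<^sup>+t. 4 * (H t * indicator {-1..1} t) + 4 * I * indicator {-1..1} t \<partial>lborel)
        = (\<integral>\<^sup>+t. 4 * (H t * indicator {-1..1} t) \<partial>lborel) + (\<integral>\<^sup>+t. 4 * I * indicator {-1..1::real} t \<partial>lborel)"
      by (rule nn_integral_add) measurable
    also have "(\<integral>\<^sup>+t. 4 * (H t * indicator {-1..1} t) \<partial>lborel) = 4 * I"
      unfolding IH by (rule nn_integral_cmult) measurable
    also have "(\<integral>\<^sup>+t. 4 * I * indicator {-1..1::real} t \<partial>lborel) = 4 * I * 2"
      by (subst nn_integral_cmult_indicator) auto
    finally show "(\<integral>\<^sup>+t. (4 * H t + 4 * I) * (indicator {-1..1} s * indicator {-1..1} t) \<partial>lborel)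
        = indicator {-1..1} s * (4 * I + 4 * I * 2)" .
  qed
  also have "(\<integral>\<^sup>+s. indicator {-1..1::real} s * (4 * I + 4 * I * 2) \<partial>lborel) = 2 * (4 * I + 4 * I * 2)"
    by (subst nn_integral_multc) simp_all
  also have "\<dots> = 24 * I"
  proof -
    have "2 * (4 * I + 4 * I * 2) = (2 * (4 + 4 * 2)) * I" by (simp only: distrib_left distrib_right mult_ac)
    then show ?thesis by simp
  qed
  also have "I \<le> (\<integral>\<^sup>+x. ennreal (exp 2) * (ennreal ((norm (D x))\<^sup>2 * exp (- (norm x)\<^sup>2)) * indicator Q x) \<partial>lborel)"
    unfolding I_def
  proof (rule nn_integral_mono)
    fix x
    show "G x * indicator Q x \<le> ennreal (exp 2) * (ennreal ((norm (D x))\<^sup>2 * exp (- (norm x)\<^sup>2)) * indicator Q x)"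
    proof (cases "x \<in> Q")
      case True
      have "(norm x)\<^sup>2 = (x \<bullet> e)\<^sup>2 + (x \<bullet> e')\<^sup>2"
        by (subst vec_eq_frame) (rule norm_frame)
      moreover have "(x \<bullet> e)\<^sup>2 \<le> 1" "(x \<bullet> e')\<^sup>2 \<le> 1"
        using True by (auto simp: Q_def abs_square_le_1)
      ultimately have "1 \<le> exp (2 - (norm x)\<^sup>2)" by simp
      then have "(norm (D x))\<^sup>2 * 1 \<le> (norm (D x))\<^sup>2 * exp (2 - (norm x)\<^sup>2)"
        by (rule mult_left_mono) simp
      then have "(norm (D x))\<^sup>2 \<le> exp 2 * ((norm (D x))\<^sup>2 * exp (- (norm x)\<^sup>2))"
        by (simp add: exp_diff exp_minus field_simps)
      then show ?thesis using True by (simp add: G_def ennreal_mult[symmetric] ennreal_leI)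
    qed simp
  qed
  also have "\<dots> = ennreal (exp 2) * energy Q"
    unfolding energy_def by (subst nn_integral_cmult) simp_all
  finally have "mass a Q \<le> 24 * (ennreal (exp 2) * energy Q)" by (simp add: mult_left_mono)
  then show ?thesis by (auto simp: ennreal_mult mult.assoc)
qed

end

section \<open>Rotating the cap to the front of the disc\<close>

lemma rotation_sum_squares:
  fixes a b \<theta> :: real
  shows "(cos \<theta> * a - sin \<theta> * b)\<^sup>2 + (sin \<theta> * a + cos \<theta> * b)\<^sup>2 = a\<^sup>2 + b\<^sup>2"
proof -
  have "(c * a - s * b)\<^sup>2 + (s * a + c * b)\<^sup>2 = (s\<^sup>2 + c\<^sup>2) * (a\<^sup>2 + b\<^sup>2)" for c s :: real
    by (simp add: power2_eq_square algebra_simps)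
  from this[of "cos \<theta>" "sin \<theta>"] show ?thesis by simp
qed

context obstacle_gradient begin

definition rot :: "real \<Rightarrow> real^2 \<Rightarrow> real^2" where
  "rot \<theta> z = (cos \<theta> * (z \<bullet> e) - sin \<theta> * (z \<bullet> e')) *\<^sub>R e + (sin \<theta> * (z \<bullet> e) + cos \<theta> * (z \<bullet> e')) *\<^sub>R e'"

definition turn :: "real \<Rightarrow> real^2 \<Rightarrow> real^2" where
  "turn \<theta> x = Y *\<^sub>R e + rot \<theta> (x - Y *\<^sub>R e)"

lemma rot_coordinates:
  "rot \<theta> z \<bullet> e = cos \<theta> * (z \<bullet> e) - sin \<theta> * (z \<bullet> e')"
  "rot \<theta> z \<bullet> e' = sin \<theta> * (z \<bullet> e) + cos \<theta> * (z \<bullet> e')"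
  by (simp_all add: rot_def frame_coordinates)

lemma norm_vec: "(norm z)\<^sup>2 = (z \<bullet> e)\<^sup>2 + (z \<bullet> e')\<^sup>2"
  by (subst vec_eq_frame) (rule norm_frame)

lemma norm_rot: "norm (rot \<theta> z) = norm z"
proof -
  have "(norm (rot \<theta> z))\<^sup>2 = (norm z)\<^sup>2"
    unfolding norm_vec rot_coordinates by (rule rotation_sum_squares)
  then show ?thesis by simp
qed

lemma orthogonal_rot: "orthogonal_transformation (rot \<theta>)"
  unfolding orthogonal_transformation
proof (intro conjI allI linearI)
  show "rot \<theta> (u + v) = rot \<theta> u + rot \<theta> v" "rot \<theta> (c *\<^sub>R u) = c *\<^sub>R rot \<theta> u" for u v c
    by (simp_all add: rot_def algebra_simps)
qed (rule norm_rot)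

lemma measurable_turn[measurable]:
  assumes [measurable]: "g \<in> borel_measurable M" "h \<in> borel_measurable M"
  shows "(\<lambda>x. turn (g x) (h x)) \<in> borel_measurable M"
  unfolding turn_def rot_def by measurable

text \<open>\<open>turn \<theta>\<close> is an orthogonal map conjugated by a translation, and both
  preserve Lebesgue measure.\<close>

lemma nn_integral_turn:
  assumes [measurable]: "h \<in> borel_measurable borel"
  shows "(\<integral>\<^sup>+x. h (turn \<theta> x) \<partial>lborel) = (\<integral>\<^sup>+x. h x \<partial>lborel)"
proof -
  have [measurable]: "rot \<theta> \<in> borel_measurable borel" unfolding rot_def by measurable
  have tr: "(\<integral>\<^sup>+x. k x \<partial>lborel) = (\<integral>\<^sup>+x. k (c + x) \<partial>lborel)"
    if [measurable]: "k \<in> borel_measurable borel" for k and c :: "real^2"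
    by (subst lborel_distr_plus[of c, symmetric]) (simp add: nn_integral_distr)
  have "(\<integral>\<^sup>+x. h x \<partial>lborel) = (\<integral>\<^sup>+x. h (Y *\<^sub>R e + x) \<partial>lborel)"
    by (rule tr) measurable
  also have "\<dots> = (\<integral>\<^sup>+x. h (Y *\<^sub>R e + rot \<theta> x) \<partial>lborel)"
    by (subst lborel_distr_orthogonal_transformation[OF orthogonal_rot[of \<theta>], symmetric])
      (simp add: nn_integral_distr)
  also have "\<dots> = (\<integral>\<^sup>+x. h (Y *\<^sub>R e + rot \<theta> (- (Y *\<^sub>R e) + x)) \<partial>lborel)"
    by (rule tr) measurable
  finally show ?thesis by (simp add: turn_def)
qed

lemma turn_0: "turn 0 x = x"
  by (simp add: turn_def rot_def vec_eq_frame[symmetric])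

text \<open>The law of cosines. Only the last term depends on \<open>\<theta>\<close>, so comparing
  Gaussian weights along the arc amounts to comparing components along \<open>e\<close>.\<close>

lemma norm_turn: "(norm (turn \<theta> x))\<^sup>2 = Y\<^sup>2 + (norm (x - Y *\<^sub>R e))\<^sup>2 + 2 * Y * (rot \<theta> (x - Y *\<^sub>R e) \<bullet> e)"
  unfolding turn_def norm_rot[symmetric, of "x - _" \<theta>] power2_norm_eq_inner
  by (simp add: inner_add_left inner_add_right frame_inner inner_commute power2_eq_square)

lemma turn_in_\<Omega>: "x \<in> cap \<Longrightarrow> turn \<theta> x \<in> \<Omega>"
  by (simp add: cap_def \<Omega>_def turn_def norm_rot)

text \<open>A half turn changes the sign of the component along \<open>e\<close> relative to the
  center, which excludes \<open>shadow\<close>. Fixing \<open>\<omega>\<close> through its cosine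
  and sine covers both \<open>pi\<close> and \<open>-pi\<close>.\<close>

lemma turn_in_front:
  assumes "x \<in> cap" "cos \<omega> = -1" "sin \<omega> = 0"
  shows "turn \<omega> x \<in> front"
proof -
  have "turn \<omega> x \<in> \<Omega>" by (rule turn_in_\<Omega>[OF assms(1)])
  moreover have "turn \<omega> x \<bullet> e < Y"
    using assms by (simp add: turn_def inner_add_left inner_diff_left rot_coordinates frame_inner cap_def)
  then have "turn \<omega> x \<notin> shadow"
    using root_nonneg[of "turn \<omega> x \<bullet> e'"] unfolding shadow_def mem_Collect_eq by linarith
  ultimately show ?thesis using \<Omega>_subset by blast
qed

text \<open>\<open>W\<close> is the velocity of the circular path through \<open>x\<close>; its
  speed is the radius of the circle.\<close>

lemma der_turn:
  obtains W where "\<And>\<theta>. ((\<lambda>\<theta>. f (turn \<theta> x) - a) has_real_derivative D (turn \<theta> x) \<bullet> W \<theta>) (at \<theta>)"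
    "continuous_on UNIV (\<lambda>\<theta>. D (turn \<theta> x) \<bullet> W \<theta>)" "\<And>\<theta>. norm (W \<theta>) = norm (x - Y *\<^sub>R e)"
proof -
  define z where "z = x - Y *\<^sub>R e"
  define W where "W \<theta> = (- (sin \<theta> * (z \<bullet> e) + cos \<theta> * (z \<bullet> e'))) *\<^sub>R e
    + (cos \<theta> * (z \<bullet> e) - sin \<theta> * (z \<bullet> e')) *\<^sub>R e'" for \<theta>
  have turn: "turn \<theta> x = Y *\<^sub>R e + ((cos \<theta> * (z \<bullet> e) - sin \<theta> * (z \<bullet> e')) *\<^sub>R e
    + (sin \<theta> * (z \<bullet> e) + cos \<theta> * (z \<bullet> e')) *\<^sub>R e')" for \<theta>
    by (simp add: turn_def rot_def z_def)
  have W: "((\<lambda>\<theta>. turn \<theta> x) has_vector_derivative W \<theta>) (at \<theta>)" for \<theta>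
    unfolding turn W_def
    by (auto intro!: derivative_eq_intros simp: has_vector_derivative_def algebra_simps)
  have d: "((\<lambda>\<theta>. f (turn \<theta> x) - a) has_real_derivative D (turn \<theta> x) \<bullet> W \<theta>) (at \<theta>)" for \<theta>
  proof -
    have "((\<lambda>\<theta>. f (turn \<theta> x)) has_derivative (\<lambda>h. D (turn \<theta> x) \<bullet> (h *\<^sub>R W \<theta>))) (at \<theta>)"
      using has_derivative_compose[OF W[unfolded has_vector_derivative_def] der] .
    from has_derivative_diff[OF this has_derivative_const[of a]] show ?thesis
      by (simp add: has_field_derivative_def mult_commute_abs)
  qed
  have "continuous_on UNIV (\<lambda>\<theta>. turn \<theta> x)"
    unfolding turn by (intro continuous_intros)
  then have c: "continuous_on UNIV (\<lambda>\<theta>. D (turn \<theta> x) \<bullet> W \<theta>)"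
    unfolding W_def by (intro continuous_intros continuous_on_compose2[OF contD]) auto
  have n: "norm (W \<theta>) = norm (x - Y *\<^sub>R e)" for \<theta>
  proof -
    have "(norm (W \<theta>))\<^sup>2 = (norm z)\<^sup>2"
      unfolding W_def norm_frame norm_vec[of z] power2_minus
      by (subst add.commute) (rule rotation_sum_squares)
    then show ?thesis by (simp add: z_def)
  qed
  show ?thesis by (rule that[OF d c n])
qed

text \<open>The value at \<open>x\<close> is compared with that at the rotated point by
  Cauchy-Schwarz along the arc. By \<open>closer\<close> the weight at \<open>x\<close> is at most
  the weight anywhere on the arc, so it may be moved inside the integral. One factor
  \<open>u - l\<close> comes from Cauchy-Schwarz, the other from integrating over the angle;
  \<open>(r + 1)\<^sup>2\<close> bounds the squared speed.\<close>

lemma mass_half_cap: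
  assumes B: "B \<subseteq> cap" and [measurable]: "B \<in> sets borel"
    and ivl: "0 \<in> {l..u}" "\<omega> \<in> {l..u}" "cos \<omega> = -1" "sin \<omega> = 0"
    and closer: "\<And>x \<theta>. x \<in> B \<Longrightarrow> \<theta> \<in> {l..u} \<Longrightarrow> rot \<theta> (x - Y *\<^sub>R e) \<bullet> e \<le> (x - Y *\<^sub>R e) \<bullet> e"
  shows "mass a B \<le> 2 * mass a front + ennreal (2 * (u - l)\<^sup>2 * (r + 1)\<^sup>2) * energy \<Omega>"
proof -
  define M where "M x = ennreal ((f x - a)\<^sup>2 * exp (- (norm x)\<^sup>2)) * indicator front x" for x
  define E where "E x = ennreal ((norm (D x))\<^sup>2 * exp (- (norm x)\<^sup>2)) * indicator \<Omega> x" for x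
  have [measurable]: "M \<in> borel_measurable borel" "E \<in> borel_measurable borel"
    unfolding M_def E_def by measurable
  define k where "k = 2 * (u - l) * (r + 1)\<^sup>2"
  have k: "0 \<le> k" and lu: "l \<le> u" using ivl by (auto simp: k_def)
  have pt: "ennreal ((f x - a)\<^sup>2 * exp (- (norm x)\<^sup>2)) \<le> 2 * M (turn \<omega> x)
      + ennreal k * (\<integral>\<^sup>+\<theta>. E (turn \<theta> x) * indicator {l..u} \<theta> \<partial>lborel)" if x: "x \<in> B" for x
  proof -
    let ?w = "\<lambda>x::real^2. exp (- (norm x)\<^sup>2)"
    have xc: "x \<in> cap" using x B by blast
    have w: "?w x \<le> ?w (turn \<theta> x)" if "\<theta> \<in> {l..u}" for \<theta>
    proof -
      have "(norm (turn \<theta> x))\<^sup>2 \<le> (norm (turn 0 x))\<^sup>2"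
        unfolding norm_turn using closer[OF x that] r
        by (intro add_left_mono mult_left_mono) (auto simp: rot_def vec_eq_frame[symmetric])
      then show ?thesis by (simp add: turn_0)
    qed
    obtain W where W: "\<And>\<theta>. ((\<lambda>\<theta>. f (turn \<theta> x) - a) has_real_derivative D (turn \<theta> x) \<bullet> W \<theta>) (at \<theta>)"
      "continuous_on UNIV (\<lambda>\<theta>. D (turn \<theta> x) \<bullet> W \<theta>)" "\<And>\<theta>. norm (W \<theta>) = norm (x - Y *\<^sub>R e)"
      using der_turn by blast
    have nW: "norm (W \<theta>) \<le> r + 1" for \<theta> using xc by (simp add: W(3) cap_def)
    have sqW: "(D (turn \<theta> x) \<bullet> W \<theta>)\<^sup>2 \<le> (r + 1)\<^sup>2 * (norm (D (turn \<theta> x)))\<^sup>2" for \<theta>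
    proof -
      have "\<bar>D (turn \<theta> x) \<bullet> W \<theta>\<bar> \<le> norm (D (turn \<theta> x)) * (r + 1)"
        using Cauchy_Schwarz_ineq2[of "D (turn \<theta> x)" "W \<theta>"] mult_left_mono[OF nW, of "norm (D (turn \<theta> x))" \<theta>]
        by simp
      then have "\<bar>D (turn \<theta> x) \<bullet> W \<theta>\<bar>\<^sup>2 \<le> (norm (D (turn \<theta> x)) * (r + 1))\<^sup>2"
        by (rule power_mono) simp
      then show ?thesis by (simp add: power_mult_distrib mult.commute)
    qed
    have "ennreal ((f (turn \<omega> x) - f x)\<^sup>2) \<le> ennreal (u - l) * (\<integral>\<^sup>+\<theta>\<in>{l..u}. ennreal ((D (turn \<theta> x) \<bullet> W \<theta>)\<^sup>2) \<partial>lborel)"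
      using diff_square_le_nn_integral_subset[OF W(1,2) ivl(1,2)] by (simp add: turn_0)
    then have "ennreal (?w x) * ennreal ((f (turn \<omega> x) - f x)\<^sup>2)
        \<le> ennreal (?w x) * (ennreal (u - l) * (\<integral>\<^sup>+\<theta>\<in>{l..u}. ennreal ((D (turn \<theta> x) \<bullet> W \<theta>)\<^sup>2) \<partial>lborel))"
      by (rule mult_left_mono) simp
    also have "\<dots> = ennreal (u - l) * (\<integral>\<^sup>+\<theta>. ennreal (?w x) * (ennreal ((D (turn \<theta> x) \<bullet> W \<theta>)\<^sup>2) * indicator {l..u} \<theta>) \<partial>lborel)"
      using borel_measurable_continuous_onI[OF W(2)]
      by (subst nn_integral_cmult) (simp_all add: mult.left_commute)
    also have "\<dots> \<le> ennreal (u - l) * (\<integral>\<^sup>+\<theta>. ennreal ((r + 1)\<^sup>2) * (E (turn \<theta> x) * indicator {l..u} \<theta>) \<partial>lborel)"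
    proof (intro mult_left_mono nn_integral_mono)
      fix \<theta>
      show "ennreal (?w x) * (ennreal ((D (turn \<theta> x) \<bullet> W \<theta>)\<^sup>2) * indicator {l..u} \<theta>)
        \<le> ennreal ((r + 1)\<^sup>2) * (E (turn \<theta> x) * indicator {l..u} \<theta>)"
      proof (cases "\<theta> \<in> {l..u}")
        case True
        have "?w x * (D (turn \<theta> x) \<bullet> W \<theta>)\<^sup>2 \<le> ?w (turn \<theta> x) * ((r + 1)\<^sup>2 * (norm (D (turn \<theta> x)))\<^sup>2)"
          by (rule mult_mono[OF w[OF True] sqW]) simp_all
        then show ?thesis
          using True turn_in_\<Omega>[OF xc, of \<theta>]
          by (simp add: E_def ennreal_mult[symmetric] ennreal_leI mult_ac)
      qed simp
    qed simp
    also have "\<dots> = ennreal (u - l) * ennreal ((r + 1)\<^sup>2) * (\<integral>\<^sup>+\<theta>. E (turn \<theta> x) * indicator {l..u} \<theta> \<partial>lborel)"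
      by (subst nn_integral_cmult) (simp_all add: mult.assoc)
    finally have "ennreal (?w x) * ennreal ((f (turn \<omega> x) - f x)\<^sup>2)
        \<le> ennreal (u - l) * ennreal ((r + 1)\<^sup>2) * (\<integral>\<^sup>+\<theta>. E (turn \<theta> x) * indicator {l..u} \<theta> \<partial>lborel)" .
    note le = mult_left_mono[OF this zero_le, of 2]
    have "ennreal (2 * (p * q)) = 2 * (ennreal p * ennreal q)" if "0 \<le> p" "0 \<le> q" for p q
      using that by (simp add: ennreal_mult)
    then have kk: "ennreal k = 2 * (ennreal (u - l) * ennreal ((r + 1)\<^sup>2))"
      unfolding k_def mult.assoc using lu by simp
    from le     have 1: "2 * (ennreal (?w x) * ennreal ((f (turn \<omega> x) - f x)\<^sup>2))
        \<le> ennreal k * (\<integral>\<^sup>+\<theta>. E (turn \<theta> x) * indicator {l..u} \<theta> \<partial>lborel)"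
      by (simp only: kk mult.assoc)
    have 2: "ennreal ((f (turn \<omega> x) - a)\<^sup>2 * ?w x) \<le> M (turn \<omega> x)"
      using turn_in_front[OF xc ivl(3,4)] w[OF ivl(2)]
      by (simp add: M_def ennreal_leI mult_left_mono)
    have "(f x - a)\<^sup>2 \<le> 2 * (f (turn \<omega> x) - a)\<^sup>2 + 2 * (f (turn \<omega> x) - f x)\<^sup>2"
      using zero_le_power2[of "(f (turn \<omega> x) - a) + (f (turn \<omega> x) - f x)"]
      by (simp add: power2_eq_square algebra_simps)
    then have "(f x - a)\<^sup>2 * ?w x \<le> (2 * (f (turn \<omega> x) - a)\<^sup>2 + 2 * (f (turn \<omega> x) - f x)\<^sup>2) * ?w x"
      by (rule mult_right_mono) simp
    then have "ennreal ((f x - a)\<^sup>2 * ?w x)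
       \<le> ennreal (2 * ((f (turn \<omega> x) - a)\<^sup>2 * ?w x) + 2 * (?w x * (f (turn \<omega> x) - f x)\<^sup>2))"
      by (intro ennreal_leI) (simp add: algebra_simps)
    also have "\<dots> = 2 * ennreal ((f (turn \<omega> x) - a)\<^sup>2 * ?w x) + 2 * (ennreal (?w x) * ennreal ((f (turn \<omega> x) - f x)\<^sup>2))"
      by (simp add: ennreal_mult)
    also have "\<dots> \<le> 2 * M (turn \<omega> x) + ennreal k * (\<integral>\<^sup>+\<theta>. E (turn \<theta> x) * indicator {l..u} \<theta> \<partial>lborel)"
      by (intro add_mono 1 mult_left_mono 2) simp
    finally show ?thesis .
  qed
  have "mass a B \<le> (\<integral>\<^sup>+x. 2 * M (turn \<omega> x)
      + ennreal k * (\<integral>\<^sup>+\<theta>. E (turn \<theta> x) * indicator {l..u} \<theta> \<partial>lborel) \<partial>lborel)"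
    unfolding mass_def
  proof (rule nn_integral_mono)
    fix x
    show "ennreal ((f x - a)\<^sup>2 * exp (- (norm x)\<^sup>2)) * indicator B x
        \<le> 2 * M (turn \<omega> x) + ennreal k * (\<integral>\<^sup>+\<theta>. E (turn \<theta> x) * indicator {l..u} \<theta> \<partial>lborel)"
      using pt[of x] by (cases "x \<in> B") simp_all
  qed
  also have "\<dots> = 2 * (\<integral>\<^sup>+x. M (turn \<omega> x) \<partial>lborel)
      + ennreal k * (\<integral>\<^sup>+x. \<integral>\<^sup>+\<theta>. E (turn \<theta> x) * indicator {l..u} \<theta> \<partial>lborel \<partial>lborel)"
    by (subst nn_integral_add) (simp_all add: nn_integral_cmult)
  also have "(\<integral>\<^sup>+x. M (turn \<omega> x) \<partial>lborel) = mass a front"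
    by (subst nn_integral_turn) (simp_all add: M_def[abs_def] mass_def)
  \<comment> \<open>After the exchange, the inner integral for each fixed angle is
    \<open>energy \<Omega>\<close> by rotation invariance, so overlapping arcs cost only the length
    of \<open>{l..u}\<close>.\<close>
  also have "(\<integral>\<^sup>+x. \<integral>\<^sup>+\<theta>. E (turn \<theta> x) * indicator {l..u} \<theta> \<partial>lborel \<partial>lborel)
      = (\<integral>\<^sup>+\<theta>. \<integral>\<^sup>+x. E (turn \<theta> x) * indicator {l..u} \<theta> \<partial>lborel \<partial>lborel)"
    by (rule lborel_pair.Fubini'[symmetric]) measurable
  also have "\<dots> = (\<integral>\<^sup>+\<theta>. (\<integral>\<^sup>+x. E x \<partial>lborel) * indicator {l..u} \<theta> \<partial>lborel)"
    by (simp add: nn_integral_multc nn_integral_turn)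
  also have "\<dots> = energy \<Omega> * ennreal (u - l)"
    using lu by (simp add: nn_integral_cmult_indicator E_def energy_def)
  also have "ennreal k * (energy \<Omega> * ennreal (u - l)) = ennreal (2 * (u - l)\<^sup>2 * (r + 1)\<^sup>2) * energy \<Omega>"
  proof -
    have "ennreal k * ennreal (u - l) = ennreal (2 * (u - l)\<^sup>2 * (r + 1)\<^sup>2)"
      using k lu by (simp add: ennreal_mult[symmetric] k_def power2_eq_square mult_ac)
    then show ?thesis by (metis mult.assoc mult.commute)
  qed
  finally show ?thesis .
qed

text \<open>The direction of rotation follows the sign of \<open>x \<bullet> e'\<close>, so that
  \<open>sin \<theta> * (x \<bullet> e') \<ge> 0\<close> all along the arc. As
  \<open>x \<bullet> e > Y\<close> on \<open>cap\<close>, the cosine term does not increase the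
  component along \<open>e\<close> either, and the point never moves away from the origin beyond its
  initial distance.\<close>

lemma mass_cap: "mass a cap \<le> 4 * mass a front + ennreal (4 * pi\<^sup>2 * (r + 1)\<^sup>2) * energy \<Omega>"
proof -
  let ?A = "{x \<in> cap. 0 \<le> x \<bullet> e'}" and ?B = "{x \<in> cap. x \<bullet> e' \<le> 0}"
  have mb[measurable]: "?A \<in> sets borel" "?B \<in> sets borel" by measurable
  have closer: "rot \<theta> (x - Y *\<^sub>R e) \<bullet> e \<le> (x - Y *\<^sub>R e) \<bullet> e"
    if "x \<in> cap" "0 \<le> sin \<theta> * (x \<bullet> e')" for x \<theta>
  proof -
    have "cos \<theta> * (x \<bullet> e - Y) \<le> 1 * (x \<bullet> e - Y)"
      using that by (intro mult_right_mono) (auto simp: cap_def)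
    then show ?thesis
      using that by (simp add: rot_coordinates inner_diff_left frame_inner)
  qed
  have A: "mass a ?A \<le> 2 * mass a front + ennreal (2 * (pi - 0)\<^sup>2 * (r + 1)\<^sup>2) * energy \<Omega>"
  proof (rule mass_half_cap[where \<omega> = pi])
    fix x \<theta> assume "x \<in> ?A" "\<theta> \<in> {0..pi}"
    then show "rot \<theta> (x - Y *\<^sub>R e) \<bullet> e \<le> (x - Y *\<^sub>R e) \<bullet> e"
      using sin_ge_zero[of \<theta>] by (intro closer) simp_all
  qed (use mb in auto)
  have B: "mass a ?B \<le> 2 * mass a front + ennreal (2 * (0 - - pi)\<^sup>2 * (r + 1)\<^sup>2) * energy \<Omega>"
  proof (rule mass_half_cap[where \<omega> = "-pi"])
    fix x \<theta> assume "x \<in> ?B" "\<theta> \<in> {-pi..0}"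
    then show "rot \<theta> (x - Y *\<^sub>R e) \<bullet> e \<le> (x - Y *\<^sub>R e) \<bullet> e"
      using sin_ge_zero[of "-\<theta>"] by (intro closer) (simp_all add: mult_nonpos_nonpos)
  qed (use mb in auto)
  have "mass a cap = mass a (?A \<union> ?B)" by (rule arg_cong[where f = "mass a"]) auto
  also have "\<dots> \<le> mass a ?A + mass a ?B" by (rule mass_Un[OF mb])
  also have "\<dots> \<le> (2 * mass a front + ennreal (2 * pi\<^sup>2 * (r + 1)\<^sup>2) * energy \<Omega>)
      + (2 * mass a front + ennreal (2 * pi\<^sup>2 * (r + 1)\<^sup>2) * energy \<Omega>)"
    using add_mono[OF A B] by simp
  also have "\<dots> = (2 + 2) * mass a front + (ennreal (2 * pi\<^sup>2 * (r + 1)\<^sup>2) + ennreal (2 * pi\<^sup>2 * (r + 1)\<^sup>2)) * energy \<Omega>"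
    by (simp only: distrib_right add_ac)
  also have "ennreal (2 * pi\<^sup>2 * (r + 1)\<^sup>2) + ennreal (2 * pi\<^sup>2 * (r + 1)\<^sup>2) = ennreal (4 * pi\<^sup>2 * (r + 1)\<^sup>2)"
    by (subst ennreal_plus[symmetric]) auto
  finally show ?thesis by simp
qed

text \<open>One constant \<open>a\<close>, found on the square, is carried through the chain
  \<open>Q\<close>, \<open>V\<close>, \<open>front\<close>, \<open>cap\<close>,
  \<open>shadow\<close>, while all energies are enlarged to \<open>energy \<Omega>\<close>.\<close>

lemma mass_\<Omega>:
  "\<exists>a. mass a \<Omega> \<le> ennreal ((21 * (100 * (24 * exp 2) + 88) + 4 + 40 * pi\<^sup>2) * (1 + r\<^sup>2)) * energy \<Omega>"
proof -
  \<comment> \<open>\<open>k\<close> is the constant on \<open>Q\<close>, so \<open>V\<close> has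
    \<open>10 * k + 8\<close> and \<open>front\<close> has \<open>10 * (10 * k + 8) + 8 = j\<close>;
    \<open>m\<close> is the rotation cost. Then \<open>cap\<close> has \<open>4 * j + m\<close> and
    \<open>shadow\<close> has \<open>5 * (4 * j + m) + 4\<close>, and adding \<open>front\<close>
    gives \<open>21 * j + 4 + 5 * m\<close>.\<close>
  define k :: real where "k = 24 * exp 2"
  define j :: real where "j = 100 * k + 88"
  define m :: real where "m = 4 * pi\<^sup>2 * (r + 1)\<^sup>2"
  have pos: "0 \<le> k" "0 \<le> j" "0 \<le> m" by (auto simp: k_def j_def m_def)
  have lin: "ennreal p * (ennreal c * X) + ennreal q * X = ennreal (p * c + q) * X"
    if "0 \<le> p" "0 \<le> c" "0 \<le> q" for p c q X
    using that by (simp add: ennreal_plus ennreal_mult distrib_right mult.assoc)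
  obtain a where "mass a Q \<le> ennreal k * energy Q" unfolding k_def using square_poincare by blast
  also have "\<dots> \<le> ennreal k * energy \<Omega>"
    using Q_subset V_subset by (intro mult_left_mono energy_mono) auto
  finally have Q: "mass a Q \<le> ennreal k * energy \<Omega>" .
  have "mass a V \<le> 10 * (ennreal k * energy \<Omega>) + 8 * energy \<Omega>"
    by (rule order_trans[OF mass_V]) (intro add_mono mult_left_mono Q energy_mono V_subset; simp)
  then have V: "mass a V \<le> ennreal (10 * k + 8) * energy \<Omega>"
    using lin[of 10 k 8] pos by simp
  have "mass a front \<le> 10 * (ennreal (10 * k + 8) * energy \<Omega>) + 8 * energy \<Omega>"
    by (rule order_trans[OF mass_front]) (intro add_mono mult_left_mono V energy_mono front_subset; simp)
  then have front: "mass a front \<le> ennreal j * energy \<Omega>"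
    using lin[of 10 "10 * k + 8" 8] pos by (simp add: j_def add.commute)
  have "mass a cap \<le> 4 * (ennreal j * energy \<Omega>) + ennreal m * energy \<Omega>"
    unfolding m_def by (rule order_trans[OF mass_cap]) (intro add_mono mult_left_mono front order_refl; simp)
  then have cap: "mass a cap \<le> ennreal (4 * j + m) * energy \<Omega>"
    using lin[of 4 j m] pos by simp
  have "mass a shadow \<le> 5 * (ennreal (4 * j + m) * energy \<Omega>) + 4 * energy \<Omega>"
    by (rule order_trans[OF mass_shadow]) (intro add_mono mult_left_mono cap energy_mono shadow_subset; simp)
  then have shadow: "mass a shadow \<le> ennreal (5 * (4 * j + m) + 4) * energy \<Omega>"
    using lin[of 5 "4 * j + m" 4] pos by simp
  have "mass a \<Omega> \<le> mass a front + mass a shadow"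
    by (rule order_trans[OF mass_mono[OF \<Omega>_subset] mass_Un]) measurable
  also have "\<dots> \<le> ennreal j * energy \<Omega> + ennreal (5 * (4 * j + m) + 4) * energy \<Omega>"
    by (rule add_mono[OF front shadow])
  also have "\<dots> = ennreal (21 * j + 4 + 5 * m) * energy \<Omega>"
    using pos by (simp add: distrib_right[symmetric] ennreal_plus[symmetric] add_ac del: ennreal_plus)
  also have "\<dots> \<le> ennreal ((21 * j + 4 + 40 * pi\<^sup>2) * (1 + r\<^sup>2)) * energy \<Omega>"
  proof (intro mult_right_mono ennreal_leI)
    have "(r + 1)\<^sup>2 \<le> 2 * (1 + r\<^sup>2)"
      using zero_le_power2[of "r - 1"] by (simp add: power2_eq_square algebra_simps)
    from mult_left_mono[OF this, of "20 * pi\<^sup>2"] have "5 * m \<le> 40 * pi\<^sup>2 * (1 + r\<^sup>2)" by (simp add: m_def)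
    moreover have "(21 * j + 4) * 1 \<le> (21 * j + 4) * (1 + r\<^sup>2)"
      using pos by (intro mult_left_mono) auto
    ultimately show "21 * j + 4 + 5 * m \<le> (21 * j + 4 + 40 * pi\<^sup>2) * (1 + r\<^sup>2)"
      by (simp add: algebra_simps)
  qed simp
  finally show ?thesis unfolding j_def k_def by blast
qed

end

section \<open>The Poincare inequality\<close>

text \<open>\<open>gradient\<close> is a definite description, so it is first identified, by
  uniqueness of derivatives, with the vector \<open>D\<close> of partial derivatives; continuity of
  these is the first level of \<open>C_k\<close>.\<close>

lemma smooth_gradient:
  fixes f :: "'a::euclidean_space \<Rightarrow> real"
  assumes "smooth f"
  shows smooth_has_derivative: "(f has_derivative (\<lambda>h. gradient f x \<bullet> h)) (at x)"
    and smooth_continuous_gradient: "continuous_on UNIV (gradient f)"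
proof -
  define D where "D x = (\<Sum>b\<in>Basis. frechet_derivative f (at x) b *\<^sub>R b)" for x
  have "C_k (Suc 0) f" using assms unfolding smooth_def by blast
  then have diff: "f differentiable (at x)" and cont: "continuous_on UNIV (\<lambda>x. frechet_derivative f (at x) v)" for x v
    by simp_all
  have D: "GDERIV f x :> D x" for x
  proof -
    have F: "(f has_derivative frechet_derivative f (at x)) (at x)"
      using diff frechet_derivative_works by blast
    then have lin: "linear (frechet_derivative f (at x))" by (rule has_derivative_linear)
    have "frechet_derivative f (at x) h = h \<bullet> D x" for h
    proof -
      have "frechet_derivative f (at x) h = frechet_derivative f (at x) (\<Sum>b\<in>Basis. (h \<bullet> b) *\<^sub>R b)"
        by (simp only: euclidean_representation)
      also have "\<dots> = h \<bullet> D x"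
        by (simp add: D_def linear_sum[OF lin] linear_cmul[OF lin] inner_sum_right mult.commute)
      finally show ?thesis .
    qed
    then show ?thesis unfolding gderiv_def using F by (metis ext)
  qed
  have "gradient f x = D x" for x
    unfolding gradient_def
  proof (rule the_equality)
    show "GDERIV f x :> D x" by (rule D)
    fix D' assume "GDERIV f x :> D'"
    then have "(\<lambda>h. h \<bullet> D') = (\<lambda>h. h \<bullet> D x)"
      using D[of x] unfolding gderiv_def by (rule has_derivative_unique)
    then show "D' = D x" by (metis vector_eq_ldot)
  qed
  then have g: "gradient f = D" by blast
  show "(f has_derivative (\<lambda>h. gradient f x \<bullet> h)) (at x)"
    using D[of x] unfolding g gderiv_def by (simp add: inner_commute)
  show "continuous_on UNIV (gradient f)"
    unfolding g D_def by (intro continuous_intros cont)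
qed

text \<open>The second moment about \<open>a\<close> exceeds the variance by
  \<open>(expectation X - a)\<^sup>2\<close>. Hence the value of \<open>f\<close> at a point of the
  square can replace its mean.\<close>

lemma (in prob_space) variance_le_second_moment:
  fixes X :: "'a \<Rightarrow> real"
  assumes [measurable]: "random_variable borel X" and sq: "integrable M (\<lambda>x. (X x)\<^sup>2)"
  shows "integrable M (\<lambda>x. (X x - a)\<^sup>2)" "variance X \<le> expectation (\<lambda>x. (X x - a)\<^sup>2)"
proof -
  have X: "integrable M X" by (rule square_integrable_imp_integrable) (use sq in simp_all)
  have e: "(\<lambda>x. (X x - a)\<^sup>2) = (\<lambda>x. (X x)\<^sup>2 - 2 * a * X x + a\<^sup>2)"
    by (auto simp: power2_diff algebra_simps)
  show "integrable M (\<lambda>x. (X x - a)\<^sup>2)"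
    unfolding e using X sq by simp
  have "expectation (\<lambda>x. (X x - a)\<^sup>2) = expectation (\<lambda>x. (X x)\<^sup>2) - 2 * a * expectation X + a\<^sup>2"
    unfolding e using X sq by (simp add: prob_space)
  then have "expectation (\<lambda>x. (X x - a)\<^sup>2) = variance X + (expectation X - a)\<^sup>2"
    using variance_eq[OF X sq] by (simp add: power2_diff)
  then show "variance X \<le> expectation (\<lambda>x. (X x - a)\<^sup>2)" by simp
qed

definition obstacle_constant :: real where
  "obstacle_constant = 21 * (100 * (24 * exp 2) + 88) + 4 + 40 * pi\<^sup>2"

lemma obstacle_nn_integral_poincare:
  fixes f :: "real^2 \<Rightarrow> real"
  assumes f: "smooth f" and r: "0 \<le> r" "1 + r < norm y"
  shows "\<exists>a. (\<integral>\<^sup>+x. ennreal ((f x - a)\<^sup>2 * obstacle_weight y r x) \<partial>lborel)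
    \<le> ennreal (obstacle_constant * (1 + r\<^sup>2)) * (\<integral>\<^sup>+x. ennreal ((norm (gradient f x))\<^sup>2 * obstacle_weight y r x) \<partial>lborel)"
proof -
  define e where "e = y /\<^sub>R norm y"
  \<comment> \<open>A quarter turn of \<open>e\<close> completes the frame whose first axis points
    at the center of the disc.\<close>
  define e' :: "real^2" where "e' = vector [- e$2, e$1]"
  have "0 < norm y" using r by linarith
  then have ne: "norm e = 1" by (simp add: e_def)
  have "(norm e')\<^sup>2 = (norm e)\<^sup>2"
    by (simp add: e'_def power2_norm_eq_inner inner_vec_def sum_2)
  then have "norm e' = norm e" by simp
  then have ne': "norm e' = 1" using ne by simp
  have ortho: "e \<bullet> e' = 0" by (simp add: e'_def inner_vec_def sum_2)
  have y: "y = norm y *\<^sub>R e" using \<open>0 < norm y\<close> by (simp add: e_def)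
  interpret obstacle_gradient f "gradient f" e e' "norm y" r
    using ne ne' ortho r f by unfold_locales (auto intro: smooth_has_derivative smooth_continuous_gradient)
  have w: "ennreal (c * obstacle_weight y r x) = ennreal (c * exp (- (norm x)\<^sup>2)) * indicator \<Omega> x" for c x
    using y by (auto simp: obstacle_weight_def \<Omega>_def indicator_def)
  show ?thesis
    using mass_\<Omega> unfolding mass_def energy_def w obstacle_constant_def .
qed

text \<open>The factor \<open>1 / Z\<close> appears on both sides of the unnormalized inequality.
  The integrability assumptions on \<open>f\<close> and its gradient allow the passage from
  \<open>ennreal\<close> back to real integrals.\<close>

lemma obstacle_poincare_inequality:
  assumes r: "0 \<le> r" "1 + r < norm (y :: real^2)"
  shows "poincare_inequality (obstacle_measure y r) (obstacle_constant * (1 + r\<^sup>2))"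
  unfolding poincare_inequality_def
proof (intro allI impI)
  fix f :: "real^2 \<Rightarrow> real"
  let ?w = "obstacle_weight y r" and ?M = "obstacle_measure y r"
  let ?K = "obstacle_constant * (1 + r\<^sup>2)"
  assume f: "smooth f" and sq: "integrable ?M (\<lambda>x. (f x)\<^sup>2)"
    and gsq: "integrable ?M (\<lambda>x. (norm (gradient f x))\<^sup>2)"
  define Z where "Z = (LINT z|lborel. ?w z)"
  have M: "?M = density lborel (\<lambda>x. ennreal (?w x / Z))"
    by (simp add: obstacle_measure_def Z_def)
  have w0: "0 \<le> ?w x" for x by (simp add: obstacle_weight_def)
  have [measurable]: "?w \<in> borel_measurable borel" unfolding obstacle_weight_def by measurable
  have "continuous_on UNIV f"
    using smooth_has_derivative[OF f] by (meson differentiable_at_imp_differentiable_on differentiable_def differentiable_imp_continuous_on)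
  then have [measurable]: "f \<in> borel_measurable borel" by (rule borel_measurable_continuous_onI)
  have [measurable]: "gradient f \<in> borel_measurable borel"
    using smooth_continuous_gradient[OF f] by (rule borel_measurable_continuous_onI)
  show "prob_space.variance ?M f \<le> ?K * (LINT x|?M. (norm (gradient f x))\<^sup>2)"
  proof (cases "Z = 0")
    case True
    \<comment> \<open>Division by \<open>Z = 0\<close> yields \<open>0\<close>, so the measure is null.\<close>
    have "AE x in ?M. P x" for P unfolding M True by (subst AE_density) auto
    then have "(LINT x|?M. h x) = 0" for h :: "real^2 \<Rightarrow> real" by (intro integral_eq_zero_AE) blast
    then show ?thesis by simp
  next
    case False
    \<comment> \<open>A non-integrable weight would have integral \<open>0\<close> by convention, so
      \<open>Z \<noteq> 0\<close> already yields integrability.\<close>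
    have int: "integrable lborel ?w"
      using False not_integrable_integral_eq unfolding Z_def by blast
    have Z: "0 < Z"
      using False w0 by (simp add: Z_def less_le integral_nonneg)
    have nn: "(\<integral>\<^sup>+x. ennreal (h x) \<partial>?M) = ennreal (1 / Z) * (\<integral>\<^sup>+x. ennreal (h x * ?w x) \<partial>lborel)"
      if [measurable]: "h \<in> borel_measurable borel" and h: "\<And>x. 0 \<le> h x" for h
    proof -
      have "(\<integral>\<^sup>+x. ennreal (h x) \<partial>?M) = (\<integral>\<^sup>+x. ennreal (1 / Z) * ennreal (h x * ?w x) \<partial>lborel)"
        unfolding M using Z h w0
        by (subst nn_integral_density) (simp_all add: ennreal_mult[symmetric] mult_ac)
      then show ?thesis by (simp add: nn_integral_cmult)
    qed
    have "(\<integral>\<^sup>+x. ennreal (?w x) \<partial>lborel) = ennreal Z"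
      unfolding Z_def using int w0 by (intro nn_integral_eq_integral) auto
    then have "emeasure ?M (space ?M) = 1"
      using nn[of "\<lambda>_. 1"] Z by (simp add: ennreal_mult[symmetric])
    then interpret M: prob_space ?M by (rule prob_spaceI)
    obtain a where a: "(\<integral>\<^sup>+x. ennreal ((f x - a)\<^sup>2 * ?w x) \<partial>lborel)
      \<le> ennreal ?K * (\<integral>\<^sup>+x. ennreal ((norm (gradient f x))\<^sup>2 * ?w x) \<partial>lborel)"
      using obstacle_nn_integral_poincare[OF f r] by blast
    have rv: "f \<in> borel_measurable ?M" unfolding M by simp
    note sm = M.variance_le_second_moment[OF rv sq, of a]
    have K: "0 \<le> ?K" by (simp add: obstacle_constant_def)
    have "ennreal (LINT x|?M. (f x - a)\<^sup>2) = (\<integral>\<^sup>+x. ennreal ((f x - a)\<^sup>2) \<partial>?M)"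
      using sm(1) by (subst nn_integral_eq_integral) auto
    also have "\<dots> \<le> ennreal (1 / Z) * (ennreal ?K * (\<integral>\<^sup>+x. ennreal ((norm (gradient f x))\<^sup>2 * ?w x) \<partial>lborel))"
      by (subst nn) (use a in \<open>auto intro: mult_left_mono\<close>)
    also have "\<dots> = ennreal ?K * (\<integral>\<^sup>+x. ennreal ((norm (gradient f x))\<^sup>2) \<partial>?M)"
      by (subst nn) (auto simp: mult_ac)
    also have "\<dots> = ennreal (?K * (LINT x|?M. (norm (gradient f x))\<^sup>2))"
      using gsq K by (subst nn_integral_eq_integral) (auto simp: ennreal_mult)
    finally have "(LINT x|?M. (f x - a)\<^sup>2) \<le> ?K * (LINT x|?M. (norm (gradient f x))\<^sup>2)"
      using K by (subst (asm) ennreal_le_iff) (auto intro!: mult_nonneg_nonneg)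
    with sm(2) show ?thesis by simp
  qed
qed

theorem theorem9p8:
  shows "\<exists>c C :: real. \<forall>r \<ge> 0. \<forall>y :: real^2.
           norm y > 1 + r + c * (1 + sqrt r) \<longrightarrow>
           poincare_constant (obstacle_measure y r) \<le> ereal (C * (1 + r\<^sup>2))"
proof (intro exI allI impI)
  fix r :: real and y :: "real^2"
  \<comment> \<open>The form of this assumption fixes the witness \<open>0\<close> for
    \<open>c\<close>; the witness for \<open>C\<close> is \<open>obstacle_constant\<close>.\<close>
  assume "0 \<le> r" "1 + r + 0 * (1 + sqrt r) < norm y"
  then have "poincare_inequality (obstacle_measure y r) (obstacle_constant * (1 + r\<^sup>2))"
    by (intro obstacle_poincare_inequality) simp_all
  then show "poincare_constant (obstacle_measure y r) \<le> ereal (obstacle_constant * (1 + r\<^sup>2))"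
    unfolding poincare_constant_def by (blast intro: Inf_lower)
qed

end
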